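(* Let $c>0$, let $\omega=(\omega_n)_{n\ge1}$ be an i.i.d. sequence of random points uniformly distributed on $\mathbb{T}=\mathbb{R}/\mathbb{Z}$, let $r_n=\frac cn$ for all $n\ge 1$, and let $\mathcal{U}(\omega)=\{y\in\mathbb{T}:\ \exists N_0\ \forall N\ge N_0\ \exists\, 1\le n\le N,\ \|\omega_n-y\|<r_N\}$. Then for every real $\theta>1$, almost surely $$\dim_{\mathrm H}\mathcal{U}(\omega)\ge 1-\frac{-\log\bigl(1-\exp\bigl(-2c\frac{\theta-1}{\theta^2}\bigr)\bigr)}{\log\theta}.$$ In particular (taking $\theta=8.6$), if $r_n=\frac1n$ for all $n\ge 1$, then almost surely $$\dim_{\mathrm H}\mathcal{U}(\omega)\ge 0.2177444298485995.$$
   Context: $\mathbb{T}=\mathbb{R}/\mathbb{Z}$ is the one-dimensional torus with normalized Lebesgue (uniform) measure, $\|x\|$ denotes the distance of $x\in\mathbb{T}$ to $0$ (the distance of a real representative of $x$ to the nearest integer), and $\dim_{\mathrm H}$ is the Hausdorff dimension with respect to the metric $\|x-y\|$. *)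

theory Defs
  imports "HOL-Probability.Probability"
begin

quotient_type torus = real / "\<lambda>x y :: real. x - y \<in> \<int>"
  morphisms rep_torus to_torus
proof (rule equivpI)
  show "reflp (\<lambda>x y :: real. x - y \<in> \<int>)"
    by (simp add: reflp_def)
  show "symp (\<lambda>x y :: real. x - y \<in> \<int>)"
    by (metis (no_types, lifting) Ints_minus minus_diff_eq sympI)
  show "transp (\<lambda>x y :: real. x - y \<in> \<int>)"
    by (rule transpI) (metis Ints_add diff_add_cancel add_diff_eq)
qed

instantiation torus :: ab_group_add
begin

lift_definition zero_torus :: torus is 0 .

lift_definition plus_torus :: "torus \<Rightarrow> torus \<Rightarrow> torus" is "(+)"
  by (metis Ints_add add_diff_add)

lift_definition uminus_torus :: "torus \<Rightarrow> torus" is uminus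
  by (metis Ints_minus minus_diff_minus)

lift_definition minus_torus :: "torus \<Rightarrow> torus \<Rightarrow> torus" is "(-)"
proof -
  fix a b c d :: real
  assume "a - b \<in> \<int>" "c - d \<in> \<int>"
  then have "(a - b) - (c - d) \<in> \<int>" by (rule Ints_diff)
  moreover have "(a - b) - (c - d) = (a - c) - (b - d)" by simp
  ultimately show "(a - c) - (b - d) \<in> \<int>" by metis
qed

instance
  by standard (transfer; simp)+

end

lemma abs_diff_round_le:
  "\<bar>x - of_int (round x)\<bar> \<le> \<bar>x - of_int m\<bar>" for x :: real
  using round_diff_minimal[of x m] by simp

lift_definition torus_norm :: "torus \<Rightarrow> real" is "\<lambda>x. \<bar>x - of_int (round x)\<bar>"
proof -
  fix x y :: real
  assume "x - y \<in> \<int>"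
  then obtain k where k: "x - y = of_int k" by (rule Ints_cases)
  have "\<bar>x - of_int (round x)\<bar> \<le> \<bar>x - of_int (round y + k)\<bar>"
    by (rule abs_diff_round_le)
  also have "\<dots> = \<bar>y - of_int (round y)\<bar>" using k by simp
  finally have 1: "\<bar>x - of_int (round x)\<bar> \<le> \<bar>y - of_int (round y)\<bar>" .
  have "\<bar>y - of_int (round y)\<bar> \<le> \<bar>y - of_int (round x - k)\<bar>"
    by (rule abs_diff_round_le)
  also have "\<dots> = \<bar>x - of_int (round x)\<bar>" using k by simp
  finally show "\<bar>x - of_int (round x)\<bar> = \<bar>y - of_int (round y)\<bar>"
    using 1 by linarith
qed

lemma torus_norm_to_torus_le: "torus_norm (to_torus x) \<le> \<bar>x\<bar>"
  using abs_diff_round_le[of x 0] by (simp add: torus_norm.abs_eq)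

lemma torus_norm_eq_0_iff: "torus_norm x = 0 \<longleftrightarrow> x = 0"
proof transfer
  fix x :: real
  show "(\<bar>x - of_int (round x)\<bar> = 0) = (x - 0 \<in> \<int>)"
    by (metis Ints_cases Ints_of_int abs_eq_0 diff_0_right eq_iff_diff_eq_0 round_of_int)
qed

lemma torus_norm_triangle: "torus_norm (x - y) \<le> torus_norm x + torus_norm y"
proof transfer
  fix x y :: real
  have "\<bar>(x - y) - of_int (round (x - y))\<bar> \<le> \<bar>(x - y) - of_int (round x - round y)\<bar>"
    by (rule abs_diff_round_le)
  also have "\<dots> \<le> \<bar>x - of_int (round x)\<bar> + \<bar>y - of_int (round y)\<bar>" by simp
  finally show "\<bar>(x - y) - of_int (round (x - y))\<bar>
      \<le> \<bar>x - of_int (round x)\<bar> + \<bar>y - of_int (round y)\<bar>" .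
qed

instantiation torus :: metric_space
begin

definition dist_torus :: "torus \<Rightarrow> torus \<Rightarrow> real"
  where "dist_torus x y = torus_norm (x - y)"

definition uniformity_torus :: "(torus \<times> torus) filter"
  where "uniformity_torus = (INF e\<in>{0<..}. principal {(x, y). dist x y < e})"

definition open_torus :: "torus set \<Rightarrow> bool"
  where "open_torus U \<longleftrightarrow> (\<forall>x\<in>U. eventually (\<lambda>(x', y). x' = x \<longrightarrow> y \<in> U) uniformity)"

instance
proof
  fix x y z :: torus
  show "(dist x y = 0) = (x = y)"
    by (simp add: dist_torus_def torus_norm_eq_0_iff)
  show "dist x y \<le> dist x z + dist y z"
    using torus_norm_triangle[of "x - z" "y - z"] by (simp add: dist_torus_def)
qed (simp_all only: uniformity_torus_def open_torus_def)

end

definition torus_uniform :: "torus measure"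
  where "torus_uniform = distr (uniform_measure lborel {0..<1}) borel to_torus"

lemma continuous_on_to_torus: "continuous_on UNIV to_torus"
proof -
  have "dist (to_torus x) (to_torus y) \<le> dist x y" for x y
    using torus_norm_to_torus_le[of "x - y"]
    by (simp add: dist_torus_def minus_torus.abs_eq dist_real_def)
  then show ?thesis
    unfolding continuous_on_iff by (meson le_less_trans)
qed

lemma measurable_to_torus [measurable]: "to_torus \<in> borel_measurable borel"
  by (rule borel_measurable_continuous_onI[OF continuous_on_to_torus])

lemma prob_space_torus_uniform: "prob_space torus_uniform"
  unfolding torus_uniform_def
proof (rule prob_space.prob_space_distr)
  show "prob_space (uniform_measure lborel {0..<1::real})"
    by (rule prob_space_uniform_measure) simp_all
qed simp

text \<open>
  The empty set has weight \<open>0\<close> and every nonempty set has weight \<open>1\<close> if \<open>s = 0\<close>;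
  the case distinction is needed because \<open>0 powr 0 = 0\<close>.
\<close>

definition hausdorff_weight :: "real \<Rightarrow> 'a::metric_space set \<Rightarrow> ennreal"
  where "hausdorff_weight s U =
    (if U = {} then 0 else if s = 0 then 1 else ennreal (diameter U powr s))"

text \<open>
  Boundedness is required separately because \<open>diameter\<close> is an unspecified real number
  on unbounded sets.
\<close>

definition hausdorff_premeasure :: "real \<Rightarrow> real \<Rightarrow> 'a::metric_space set \<Rightarrow> ennreal"
  where "hausdorff_premeasure s \<delta> A =
    (INF U \<in> {U :: nat \<Rightarrow> 'a set. A \<subseteq> (\<Union>i. U i) \<and> (\<forall>i. bounded (U i) \<and> diameter (U i) \<le> \<delta>)}.
      \<Sum>i. hausdorff_weight s (U i))"

definition hausdorff_measure :: "real \<Rightarrow> 'a::metric_space set \<Rightarrow> ennreal"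
  where "hausdorff_measure s A = (SUP \<delta>\<in>{0<..}. hausdorff_premeasure s \<delta> A)"

definition hausdorff_dim :: "'a::metric_space set \<Rightarrow> ereal"
  where "hausdorff_dim A = (INF s \<in> {s. 0 \<le> s \<and> hausdorff_measure s A = 0}. ereal s)"

definition uniform_cover_set :: "(nat \<Rightarrow> real) \<Rightarrow> (nat \<Rightarrow> torus) \<Rightarrow> torus set"
  where "uniform_cover_set r w =
    {y. \<exists>N\<^sub>0. \<forall>N\<ge>N\<^sub>0. \<exists>n. 1 \<le> n \<and> n \<le> N \<and> torus_norm (w n - y) < r N}"

end

theory Submission
  imports Defs
begin

text \<open>
  Cut the sequence of points into the blocks \<open>N\<^sub>k < n \<le> N\<^bsub>k+1\<^esub>\<close> with \<open>N\<^sub>k \<approx> \<theta>\<^sup>k\<close>, and ask that at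
  every late stage \<open>k\<close> the point \<open>y\<close> lies within \<open>\<rho>\<^sub>k = c / N\<^bsub>k+2\<^esub>\<close> of some point of block \<open>k\<close>.
  The radius \<open>c / R\<close> exceeds \<open>\<rho>\<^sub>k\<close> as long as \<open>R < N\<^bsub>k+2\<^esub>\<close>, so such a \<open>y\<close> is uniformly covered
  (\<open>mem_uniform_cover_set_of_blocks\<close>). This subset is easier to study than the whole set because
  distinct stages use distinct points and are therefore independent. A fixed point survives stage
  \<open>k\<close>, whose block has \<open>l\<^sub>k\<close> points, with probability \<open>p\<^sub>k = 1 - (1 - 2 \<rho>\<^sub>k)\<^bsup>l\<^sub>k\<^esup>\<close>, which tends to
  \<open>P = 1 - exp (- 2 c (\<theta> - 1) / \<theta>\<^sup>2)\<close>. Scales shrink by the factor \<open>\<theta>\<close> and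
  the density of survivors by \<open>P\<close>, which suggests the dimension \<open>1 - t\<close> with \<open>\<theta>\<^sup>t = 1 / P\<close>.

  The lower bound comes from the second moment method. Normalise the indicator of surviving the
  stages \<open>m, \<dots>, n - 1\<close> to the random density \<open>\<Prod>\<^sub>k 1\<^bsub>hit k\<^esub> / p\<^sub>k\<close>, which has mean \<open>1\<close> at each point.
  Two points at distance more than \<open>2 \<rho>\<^sub>k\<close> are negatively correlated at stage \<open>k\<close>
  (\<open>prob_hit_pair_far\<close>), and at the remaining stages, about \<open>log\<^sub>\<theta> (1 / distance) - m\<close> in number, the
  price is at most \<open>1 / p\<^sub>k\<close> each; hence the correlation of the densities at \<open>x\<close> and \<open>y\<close> is at most
  \<open>1 + G q\<^sup>m \<bar>x - y\<bar>\<^bsup>-t\<^esup>\<close> (\<open>prod_overlap_le\<close>), where \<open>q < P\<close> is a lower bound for the \<open>p\<^sub>k\<close> and now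
  \<open>\<theta>\<^sup>t = 1 / q\<close>. Integrating this against \<open>\<bar>x - y\<bar>\<^bsup>-s\<^esup>\<close> bounds the expected \<open>s\<close>-energy uniformly in \<open>n\<close>
  whenever \<open>s + t < 1\<close>, and integrating it against \<open>1\<close> shows that the variance of the total mass
  tends to \<open>0\<close> as \<open>m\<close> grows. So for large \<open>m\<close>, with probability close to \<open>1\<close>, infinitely many of
  the densities have mass bounded below and energy bounded above. It is because the variance tends to
  \<open>0\<close>, and is not merely bounded, that the probability comes close to \<open>1\<close>.

  That such densities force the limit set to have dimension at least \<open>s\<close>
  (\<open>hausdorff_dim_ge_of_energy\<close>) is Frostman's energy criterion, stated for a sequence of densities in
  place of a limit measure: an open cover of a decreasing intersection of compact sets already covers
  one of these sets, hence carries the mass of one of the densities.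

  The torus enters only through an arc of length \<open>1/2\<close>, on which it is isometric to an interval;
  the argument runs on \<open>{1/8..3/8}\<close>, whose points stay in that interval when moved by at most
  \<open>1/8\<close>.
\<close>

section \<open>Hausdorff dimension and expanding maps\<close>

text \<open>
  A cover of \<open>T\<close> pulls back along \<open>f\<close> to a cover of \<open>S\<close> by sets of no larger diameter.
\<close>

lemma hausdorff_dim_le_of_expanding:
  fixes f :: "'a::metric_space \<Rightarrow> 'b::metric_space"
  assumes exp: "\<And>x y. x \<in> S \<Longrightarrow> y \<in> S \<Longrightarrow> dist x y \<le> dist (f x) (f y)"
    and sub: "f ` S \<subseteq> T"
  shows "hausdorff_dim S \<le> hausdorff_dim T"
proof -
  have pre: "hausdorff_premeasure s \<delta> S \<le> hausdorff_premeasure s \<delta> T" if "0 \<le> s" for s \<delta>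
    unfolding hausdorff_premeasure_def
  proof (rule INF_mono)
    fix U :: "nat \<Rightarrow> 'b set"
    assume "U \<in> {U. T \<subseteq> (\<Union>i. U i) \<and> (\<forall>i. bounded (U i) \<and> diameter (U i) \<le> \<delta>)}"
    then have cov: "T \<subseteq> (\<Union>i. U i)" and bd: "\<And>i. bounded (U i)" and dm: "\<And>i. diameter (U i) \<le> \<delta>"
      by auto
    define V where "V i = S \<inter> f -` U i" for i
    have dV: "dist x y \<le> diameter (U i)" if "x \<in> V i" "y \<in> V i" for x y i
      using that exp[of x y] diameter_bounded_bound[OF bd, of "f x" i "f y"] by (auto simp: V_def)
    have bV: "bounded (V i)" for i
    proof (cases "V i = {}")
      case False
      then obtain x where "x \<in> V i" by auto
      then show ?thesis using dV unfolding bounded_def by blast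
    qed simp
    have diamV: "diameter (V i) \<le> diameter (U i)" for i
    proof (cases "V i = {}")
      case False
      then have "(SUP (x, y)\<in>V i \<times> V i. dist x y) \<le> diameter (U i)"
        using dV by (intro cSUP_least) auto
      then show ?thesis using False by (simp add: diameter_def)
    qed (simp add: diameter_ge_0 bd)
    have "hausdorff_weight s (V i) \<le> hausdorff_weight s (U i)" for i
      using diamV[of i] diameter_ge_0[OF bV, of i] that
      by (auto simp: hausdorff_weight_def V_def intro!: ennreal_leI powr_mono2)
    then have "(\<Sum>i. hausdorff_weight s (V i)) \<le> (\<Sum>i. hausdorff_weight s (U i))"
      by (intro suminf_le) auto
    moreover have "S \<subseteq> (\<Union>i. V i)"
    proof
      fix x assume "x \<in> S"
      moreover from this obtain i where "f x \<in> U i" using cov sub by blast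
      ultimately show "x \<in> (\<Union>i. V i)" by (auto simp: V_def)
    qed
    ultimately show "\<exists>V\<in>{V. S \<subseteq> (\<Union>i. V i) \<and> (\<forall>i. bounded (V i) \<and> diameter (V i) \<le> \<delta>)}.
        (\<Sum>i. hausdorff_weight s (V i)) \<le> (\<Sum>i. hausdorff_weight s (U i))"
      using bV order_trans[OF diamV dm] by (intro bexI[of _ V]) auto
  qed
  have "hausdorff_measure s S \<le> hausdorff_measure s T" if "0 \<le> s" for s
    unfolding hausdorff_measure_def using pre[OF that] by (intro SUP_mono) auto
  then show ?thesis
    unfolding hausdorff_dim_def by (intro INF_superset_mono) (auto simp flip: le_zero_eq intro: order_trans)
qed

section \<open>Riesz kernels\<close>

text \<open>
  The value \<open>\<top>\<close> at \<open>0\<close>, where \<open>0 powr - a\<close> would be \<open>0\<close>, makes lower bounds by the kernel hold on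
  the diagonal as well.
\<close>

definition riesz_kernel :: "real \<Rightarrow> real \<Rightarrow> ennreal"
  where "riesz_kernel a u = (if u = 0 then \<top> else ennreal (\<bar>u\<bar> powr - a))"

lemma borel_measurable_riesz_kernel [measurable]:
  "riesz_kernel a \<in> borel_measurable borel"
  unfolding riesz_kernel_def[abs_def] by measurable

lemma riesz_kernel_mult: "riesz_kernel a u * riesz_kernel b u = riesz_kernel (a + b) u"
  by (auto simp: riesz_kernel_def ennreal_mult'[symmetric] powr_add[symmetric] ennreal_top_mult)

lemma riesz_kernel_ge:
  assumes "\<bar>u\<bar> \<le> d" "0 < d" "0 \<le> a"
  shows "ennreal (d powr - a) \<le> riesz_kernel a u"
  using assms by (auto simp: riesz_kernel_def intro!: ennreal_leI powr_mono2')

text \<open>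
  Translation reduces the double integral to that of \<open>u\<^bsup>-a\<^esup>\<close> near \<open>0\<close>, which converges because
  \<open>a < 1\<close>.
\<close>

lemma nn_integral_riesz_kernel_finite:
  assumes "0 \<le> a" "a < 1"
  shows "(\<integral>\<^sup>+x\<in>{l..h}. (\<integral>\<^sup>+y\<in>{l..h}. riesz_kernel a (x - y) \<partial>lborel) \<partial>lborel) < \<infinity>"
proof (cases "l \<le> h")
  case True
  define D where "D = h - l"
  have D: "0 \<le> D" using True by (simp add: D_def)
  define g where "g u = indicator {0..D} u * ennreal (u powr - a)" for u
  have [measurable]: "g \<in> borel_measurable borel" unfolding g_def[abs_def] by measurable
  have g: "(\<integral>\<^sup>+u. g u \<partial>lborel) < \<infinity>"
  proof -
    obtain I where "((\<lambda>x. x powr - a) has_integral I) {0..D}"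
      using integrable_on_powr_from_0[of "- a" D] assms D unfolding integrable_on_def by auto
    from nn_integral_has_integral_lebesgue[OF _ this]
    have "(\<integral>\<^sup>+x. ennreal (indicator {0..D} x * x powr - a) \<partial>lborel) = ennreal I" by auto
    also have "(\<lambda>x. ennreal (indicator {0..D} x * x powr - a)) = g"
      by (auto simp: g_def fun_eq_iff split: split_indicator)
    finally show ?thesis by simp
  qed
  have gm: "(\<integral>\<^sup>+y. g (y - x) \<partial>lborel) = (\<integral>\<^sup>+u. g u \<partial>lborel)"
       "(\<integral>\<^sup>+y. g (x - y) \<partial>lborel) = (\<integral>\<^sup>+u. g u \<partial>lborel)" for x
    using nn_integral_real_affine[of g 1 "- x"] nn_integral_real_affine[of g "- 1" x] by simp_all
  have inner: "(\<integral>\<^sup>+y\<in>{l..h}. riesz_kernel a (x - y) \<partial>lborel) \<le> 2 * (\<integral>\<^sup>+u. g u \<partial>lborel)"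
    if x: "x \<in> {l..h}" for x
  proof -
    have "(\<integral>\<^sup>+y\<in>{l..h}. riesz_kernel a (x - y) \<partial>lborel) \<le> (\<integral>\<^sup>+y. g (y - x) + g (x - y) \<partial>lborel)"
    proof (rule nn_integral_mono_AE)
      have "AE y in lborel. y \<noteq> x" by (rule AE_lborel_singleton)
      then show "AE y in lborel. riesz_kernel a (x - y) * indicator {l..h} y \<le> g (y - x) + g (x - y)"
      proof (eventually_elim)
        case (elim y)
        then show ?case using x
          by (cases "x < y") (auto simp: g_def riesz_kernel_def D_def split: split_indicator)
      qed
    qed
    also have "\<dots> = 2 * (\<integral>\<^sup>+u. g u \<partial>lborel)"
      by (subst nn_integral_add) (auto simp: gm mult_2)
    finally show ?thesis .
  qed
  have "(\<integral>\<^sup>+x\<in>{l..h}. (\<integral>\<^sup>+y\<in>{l..h}. riesz_kernel a (x - y) \<partial>lborel) \<partial>lborel)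
      \<le> (\<integral>\<^sup>+x. 2 * (\<integral>\<^sup>+u. g u \<partial>lborel) * indicator {l..h} x \<partial>lborel)"
    using inner by (intro nn_integral_mono) (auto split: split_indicator)
  also have "\<dots> = 2 * (\<integral>\<^sup>+u. g u \<partial>lborel) * ennreal D"
    by (subst nn_integral_cmult_indicator) (auto simp: D_def True)
  also have "\<dots> < \<infinity>" using g by (auto simp: ennreal_mult_less_top)
  finally show ?thesis .
qed simp

section \<open>The energy criterion\<close>

text \<open>
  A linearised Cauchy--Schwarz inequality. Unlike the latter it can be summed term by term in
  \<open>ennreal\<close>, with the free parameter chosen at the end.
\<close>

lemma ennreal_two_mult_le_young:
  fixes m :: ennreal
  assumes "0 < b"
  shows "2 * m \<le> ennreal b * m\<^sup>2 + ennreal (1 / b)"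
proof (cases m)
  case (real r)
  have "0 \<le> (b * r - 1)\<^sup>2 / b" using assms by simp
  also have "\<dots> = b * r\<^sup>2 + 1 / b - 2 * r"
    using assms by (simp add: field_simps power2_eq_square)
  finally have "2 * r \<le> b * r\<^sup>2 + 1 / b" by simp
  then have "ennreal (2 * r) \<le> ennreal (b * r\<^sup>2 + 1 / b)" by (rule ennreal_leI)
  moreover have "ennreal (b * r\<^sup>2 + 1 / b) = ennreal b * m\<^sup>2 + ennreal (1 / b)"
    using real assms by (simp add: ennreal_mult' ennreal_power)
  moreover have "ennreal (2 * r) = 2 * m" using real by (simp add: ennreal_mult')
  ultimately show ?thesis by simp
next
  case top
  then show ?thesis using assms by (simp add: ennreal_mult_top power2_eq_square)
qed

text \<open>
  Split the mass of \<open>f\<close> into its parts \<open>m\<^sub>i\<close> on the disjointed pieces. The kernel is at least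
  \<open>d\<^sub>i\<^bsup>-s\<^esup>\<close> on a piece of diameter \<open>d\<^sub>i\<close>, so \<open>\<Sum>\<^sub>i m\<^sub>i\<^sup>2 d\<^sub>i\<^bsup>-s\<^esup> \<le> C\<close>, and Cauchy--Schwarz gives
  \<open>a\<^sup>2 \<le> (\<Sum>\<^sub>i m\<^sub>i)\<^sup>2 \<le> C \<Sum>\<^sub>i d\<^sub>i\<^sup>s\<close>.
\<close>

lemma sum_powr_ge_of_energy:
  fixes f :: "real \<Rightarrow> ennreal" and A :: "nat \<Rightarrow> real set"
  assumes [measurable]: "f \<in> borel_measurable borel" "\<And>i. A i \<in> sets borel"
    and pos: "0 < a" "0 < C" "0 < s"
    and mass: "ennreal a \<le> (\<integral>\<^sup>+x. f x \<partial>lborel)"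
    and energy: "(\<integral>\<^sup>+x. (\<integral>\<^sup>+y. f x * f y * riesz_kernel s (x - y) \<partial>lborel) \<partial>lborel) \<le> ennreal C"
    and supp: "\<And>x. x \<notin> (\<Union>i. A i) \<Longrightarrow> f x = 0"
    and d: "\<And>i. 0 < d i" "\<And>i x y. x \<in> A i \<Longrightarrow> y \<in> A i \<Longrightarrow> \<bar>x - y\<bar> \<le> d i"
  shows "ennreal (a\<^sup>2 / C) \<le> (\<Sum>i. ennreal (d i powr s))"
proof -
  define B where "B = disjointed A"
  have [measurable]: "B i \<in> sets borel" for i
    using sets.range_disjointed_sets[of A borel] unfolding B_def by (auto simp: image_subset_iff)
  have BA: "B i \<subseteq> A i" for i unfolding B_def by (rule disjointed_subset)
  have UB: "(\<Union>i. B i) = (\<Union>i. A i)" unfolding B_def by (rule UN_disjointed_eq)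
  have dB: "disjoint_family B" unfolding B_def by (rule disjoint_family_disjointed)
  define m where "m i = (\<integral>\<^sup>+x. f x * indicator (B i) x \<partial>lborel)" for i
  define e where "e i = (\<integral>\<^sup>+x. (\<integral>\<^sup>+y. f x * f y * riesz_kernel s (x - y) * (indicator (B i) x * indicator (B i) y) \<partial>lborel) \<partial>lborel)" for i
  have me: "ennreal (d i powr - s) * (m i)\<^sup>2 \<le> e i" for i
  proof -
    have "ennreal (d i powr - s) * (m i)\<^sup>2 =
      (\<integral>\<^sup>+x. (\<integral>\<^sup>+y. ennreal (d i powr - s) * ((f x * indicator (B i) x) * (f y * indicator (B i) y)) \<partial>lborel) \<partial>lborel)"
      by (simp add: nn_integral_cmult nn_integral_multc m_def power2_eq_square)
    also have "\<dots> \<le> e i" unfolding e_def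
    proof (intro nn_integral_mono)
      fix x y
      show "ennreal (d i powr - s) * ((f x * indicator (B i) x) * (f y * indicator (B i) y))
        \<le> f x * f y * riesz_kernel s (x - y) * (indicator (B i) x * indicator (B i) y)"
        using riesz_kernel_ge[of "x - y" "d i" s] d(1)[of i] d(2)[of x i y] BA[of i] pos
        by (auto split: split_indicator simp: mult.commute[of "ennreal _"] intro!: mult_left_mono)
    qed
    finally show ?thesis .
  qed
  \<comment> \<open>the value that optimises the resulting bound \<open>2 a \<le> \<alpha> C + (\<Sum>\<^sub>i d\<^sub>i\<^sup>s) / \<alpha>\<close>\<close>
  define \<alpha> where "\<alpha> = a / C"
  have \<alpha>: "0 < \<alpha>" using pos by (simp add: \<alpha>_def)
  have young: "2 * m i \<le> ennreal \<alpha> * e i + ennreal (1 / \<alpha>) * ennreal (d i powr s)" for i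
  proof -
    have "2 * m i \<le> ennreal (\<alpha> * d i powr - s) * (m i)\<^sup>2 + ennreal (1 / (\<alpha> * d i powr - s))"
      using \<alpha> d(1)[of i] by (intro ennreal_two_mult_le_young) simp
    also have "\<dots> = ennreal \<alpha> * (ennreal (d i powr - s) * (m i)\<^sup>2) + ennreal (1 / \<alpha>) * ennreal (d i powr s)"
    proof -
      have "1 / (\<alpha> * d i powr - s) = 1 / \<alpha> * d i powr s"
        by (simp add: powr_minus_divide)
      then show ?thesis
        using \<alpha> by (simp only: ennreal_mult'[of \<alpha>] ennreal_mult'[of "1 / \<alpha>"] mult.assoc
            order_less_imp_le zero_le_divide_1_iff)
    qed
    also have "\<dots> \<le> ennreal \<alpha> * e i + ennreal (1 / \<alpha>) * ennreal (d i powr s)"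
      by (intro add_mono mult_left_mono me) auto
    finally show ?thesis .
  qed
  have "(\<Sum>i. m i) = (\<integral>\<^sup>+x. (\<Sum>i. f x * indicator (B i) x) \<partial>lborel)"
    unfolding m_def by (subst nn_integral_suminf) auto
  also have "\<dots> = (\<integral>\<^sup>+x. f x \<partial>lborel)"
    using suminf_indicator[OF dB] supp by (intro nn_integral_cong) (auto simp: UB split: split_indicator)
  finally have summ: "(\<Sum>i. m i) = (\<integral>\<^sup>+x. f x \<partial>lborel)" .
  have le1: "(\<Sum>i. indicator (B i) x * indicator (B i) y :: ennreal) \<le> 1" for x y
  proof -
    have "(\<Sum>i. indicator (B i) x * indicator (B i) y :: ennreal) \<le> (\<Sum>i. indicator (B i) x)"
      by (intro suminf_le) (auto split: split_indicator)
    also have "\<dots> \<le> 1" using suminf_indicator[OF dB, of x] by (simp add: indicator_def)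
    finally show ?thesis .
  qed
  have "(\<Sum>i. e i) = (\<integral>\<^sup>+x. (\<integral>\<^sup>+y. (\<Sum>i. f x * f y * riesz_kernel s (x - y) * (indicator (B i) x * indicator (B i) y)) \<partial>lborel) \<partial>lborel)"
    unfolding e_def by (subst nn_integral_suminf[symmetric]; measurable?)+
  also have "\<dots> \<le> (\<integral>\<^sup>+x. (\<integral>\<^sup>+y. f x * f y * riesz_kernel s (x - y) \<partial>lborel) \<partial>lborel)"
  proof (intro nn_integral_mono)
    fix x y
    show "(\<Sum>i. f x * f y * riesz_kernel s (x - y) * (indicator (B i) x * indicator (B i) y))
       \<le> f x * f y * riesz_kernel s (x - y)"
      using mult_left_mono[OF le1[of x y], of "f x * f y * riesz_kernel s (x - y)"] by simp
  qed
  finally have sume: "(\<Sum>i. e i) \<le> ennreal C" using energy by (rule order_trans)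
  have "2 * ennreal a \<le> 2 * (\<Sum>i. m i)"
    unfolding summ using mass by (intro mult_left_mono) auto
  also have "\<dots> = (\<Sum>i. 2 * m i)" by simp
  also have "\<dots> \<le> (\<Sum>i. ennreal \<alpha> * e i + ennreal (1 / \<alpha>) * ennreal (d i powr s))"
    by (intro suminf_le young) auto
  also have "\<dots> = ennreal \<alpha> * (\<Sum>i. e i) + ennreal (1 / \<alpha>) * (\<Sum>i. ennreal (d i powr s))"
    by (subst suminf_add[symmetric]) auto
  also have "\<dots> \<le> ennreal \<alpha> * ennreal C + ennreal (1 / \<alpha>) * (\<Sum>i. ennreal (d i powr s))"
    by (intro add_mono mult_left_mono sume) auto
  also have "ennreal \<alpha> * ennreal C = ennreal a"
    using pos by (simp add: \<alpha>_def flip: ennreal_mult)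
  finally have *: "2 * ennreal a \<le> ennreal a + ennreal (1 / \<alpha>) * (\<Sum>i. ennreal (d i powr s))" .
  show ?thesis
  proof (cases "\<Sum>i. ennreal (d i powr s)")
    case (real S)
    have "ennreal (2 * a) \<le> ennreal (a + 1 / \<alpha> * S)"
    proof -
      have "ennreal (a + 1 / \<alpha> * S) = ennreal a + ennreal (1 / \<alpha>) * ennreal S"
        using real pos \<alpha> by (simp add: ennreal_plus flip: ennreal_mult)
      moreover have "ennreal (2 * a) = 2 * ennreal a" using pos by (simp add: ennreal_mult')
      ultimately show ?thesis using * real by simp
    qed
    then have "a \<le> 1 / \<alpha> * S"
      using pos real \<alpha> by (subst (asm) ennreal_le_iff) (auto)
    then have "a\<^sup>2 / C \<le> S" using \<alpha> pos by (simp add: \<alpha>_def field_simps power2_eq_square)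
    then show ?thesis using real by (simp add: ennreal_leI)
  qed simp
qed

lemma exists_powr_enlargement:
  fixes d s e :: real
  assumes "0 \<le> d" "0 < s" "0 < e"
  shows "\<exists>\<eta>>0. (d + 2 * \<eta>) powr s \<le> d powr s + e"
proof -
  have "((\<lambda>\<eta>. (d + 2 * \<eta>) powr s) \<longlongrightarrow> (d + 2 * 0) powr s) (at_right 0)"
    using assms
    by (intro tendsto_powr' tendsto_intros) (auto simp: eventually_at_filter)
  then have "eventually (\<lambda>\<eta>. (d + 2 * \<eta>) powr s < d powr s + e) (at_right 0)"
    using assms by (intro order_tendstoD) auto
  then have "eventually (\<lambda>\<eta>. 0 < \<eta> \<and> (d + 2 * \<eta>) powr s < d powr s + e) (at_right 0)"
    by (intro eventually_conj eventually_at_right_less)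
  from eventually_happens'[OF trivial_limit_at_right_real this]
  show ?thesis by (auto intro: less_imp_le)
qed



text \<open>
  Any cover of the intersection can be made open at little cost, and by compactness it then covers
  some \<open>K n\<close> that supports one of the densities. So the sum of the \<open>s\<close>-th powers of the diameters is
  at least \<open>a\<^sup>2 / C\<close>, and no exponent \<open>t < s\<close> has vanishing Hausdorff measure.
\<close>

lemma hausdorff_dim_ge_of_energy:
  fixes K :: "nat \<Rightarrow> real set"
  assumes cpt: "\<And>n. compact (K n)" and dec: "decseq K"
    and pos: "0 < a" "0 < C" "0 < s"
    and ex: "\<And>n\<^sub>0. \<exists>n\<ge>n\<^sub>0. \<exists>f\<in>borel_measurable borel. (\<forall>x. x \<notin> K n \<longrightarrow> f x = 0) \<and>
        ennreal a \<le> (\<integral>\<^sup>+x. f x \<partial>lborel) \<and>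
        (\<integral>\<^sup>+x. (\<integral>\<^sup>+y. f x * f y * riesz_kernel s (x - y) \<partial>lborel) \<partial>lborel) \<le> ennreal C"
  shows "ereal s \<le> hausdorff_dim (\<Inter>n. K n)"
  unfolding hausdorff_dim_def
proof (rule INF_greatest)
  fix t assume "t \<in> {t. 0 \<le> t \<and> hausdorff_measure t (\<Inter>n. K n) = 0}"
  then have t: "0 \<le> t" and H: "hausdorff_measure t (\<Inter>n. K n) = 0" by auto
  show "ereal s \<le> ereal t"
  proof (rule ccontr)
    assume "\<not> ?thesis"
    then have ts: "t < s" by simp
    \<comment> \<open>one \<open>e\<close> for the cover and one for its enlargement stay below \<open>a\<^sup>2 / C\<close>\<close>
    define e where "e = a\<^sup>2 / C / 4"
    have e: "0 < e" using pos by (simp add: e_def)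
    have "hausdorff_premeasure t 1 (\<Inter>n. K n) \<le> hausdorff_measure t (\<Inter>n. K n)"
      unfolding hausdorff_measure_def by (rule SUP_upper) simp
    then have "hausdorff_premeasure t 1 (\<Inter>n. K n) < ennreal e" using H e by simp
    then obtain U where cov: "(\<Inter>n. K n) \<subseteq> (\<Union>i. U i)"
      and bd: "\<And>i. bounded (U i)" and d1: "\<And>i. diameter (U i) \<le> 1"
      and sum: "(\<Sum>i. hausdorff_weight t (U i)) < ennreal e"
      unfolding hausdorff_premeasure_def INF_less_iff by blast
    have d0: "0 \<le> diameter (U i)" for i by (rule diameter_ge_0[OF bd])
    have "\<forall>i. \<exists>\<eta>. 0 < \<eta> \<and> (diameter (U i) + 2 * \<eta>) powr s \<le> diameter (U i) powr s + e * (1/2) ^ Suc i"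
    proof
      fix i
      have "0 < e * (1/2) ^ Suc i" using e by simp
      from exists_powr_enlargement[OF d0 pos(3) this, of i]
      show "\<exists>\<eta>. 0 < \<eta> \<and> (diameter (U i) + 2 * \<eta>) powr s \<le> diameter (U i) powr s + e * (1/2) ^ Suc i" .
    qed
    from choice[OF this] obtain \<eta> where \<eta>: "\<And>i. 0 < \<eta> i"
      and \<eta>_le: "\<And>i. (diameter (U i) + 2 * \<eta> i) powr s \<le> diameter (U i) powr s + e * (1/2) ^ Suc i"
      by blast
    define A where "A i = (\<Union>u\<in>U i. ball u (\<eta> i))" for i
    have opA: "open (A i)" for i unfolding A_def by auto
    have UA: "U i \<subseteq> A i" for i using \<eta> unfolding A_def by auto
    define d where "d i = diameter (U i) + 2 * \<eta> i" for i
    have d: "0 < d i" for i using d0[of i] \<eta>[of i] by (simp add: d_def)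
    have dA: "\<bar>x - y\<bar> \<le> d i" if "x \<in> A i" "y \<in> A i" for i x y
    proof -
      obtain u v where "u \<in> U i" "v \<in> U i" "dist u x < \<eta> i" "dist v y < \<eta> i"
        using \<open>x \<in> A i\<close> \<open>y \<in> A i\<close> by (auto simp: A_def)
      moreover from this have "dist u v \<le> diameter (U i)" by (intro diameter_bounded_bound bd)
      ultimately show ?thesis by (simp add: d_def dist_real_def)
    qed
    have "\<exists>n. K n \<subseteq> (\<Union>i. A i)"
    proof (rule ccontr)
      assume no: "\<not> ?thesis"
      have op: "open (\<Union>i. A i)" using opA by blast
      have "(\<Inter>n. K n - (\<Union>i. A i)) \<noteq> {}"
      proof (rule compact_nest)
        show "compact (K n - (\<Union>i. A i))" for n by (rule compact_diff[OF cpt op])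
        show "K n - (\<Union>i. A i) \<noteq> {}" for n using no by (simp add: Diff_eq_empty_iff)
        show "K n - (\<Union>i. A i) \<subseteq> K m - (\<Union>i. A i)" if "m \<le> n" for m n
          by (rule Diff_mono[OF decseqD[OF dec that] order_refl])
      qed
      then obtain x where x: "\<And>n. x \<in> K n" "x \<notin> (\<Union>i. A i)" by blast
      then obtain i where "x \<in> U i" using cov by (meson INT_I UN_E subsetD)
      then show False using x(2) UA by blast
    qed
    then obtain n\<^sub>0 where n0: "K n\<^sub>0 \<subseteq> (\<Union>i. A i)" by blast
    obtain n f where n: "n\<^sub>0 \<le> n" and f: "f \<in> borel_measurable borel"
      and supp: "\<And>x. x \<notin> K n \<Longrightarrow> f x = 0" and mass: "ennreal a \<le> (\<integral>\<^sup>+x. f x \<partial>lborel)"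
      and energy: "(\<integral>\<^sup>+x. (\<integral>\<^sup>+y. f x * f y * riesz_kernel s (x - y) \<partial>lborel) \<partial>lborel) \<le> ennreal C"
      using ex[of n\<^sub>0] by (elim exE conjE bexE) (erule that; simp)
    have "K n \<subseteq> (\<Union>i. A i)" using n0 decseqD[OF dec n] by (rule order_trans[rotated])
    then have "f x = 0" if "x \<notin> (\<Union>i. A i)" for x using supp that by blast
    then have "ennreal (a\<^sup>2 / C) \<le> (\<Sum>i. ennreal (d i powr s))"
      using borel_open[OF opA] by (intro sum_powr_ge_of_energy[OF f _ pos mass energy _ d dA])
    also have "\<dots> \<le> (\<Sum>i. hausdorff_weight t (U i) + ennreal (e * (1/2) ^ Suc i))"
    proof (intro suminf_le)
      fix i
      have "ennreal (d i powr s) \<le> ennreal (diameter (U i) powr s) + ennreal (e * (1/2) ^ Suc i)"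
        using \<eta>_le[of i] e by (simp add: d_def ennreal_leI flip: ennreal_plus)
      \<comment> \<open>as diameters are at most \<open>1\<close>, lowering the exponent only increases the weight\<close>
      also have "ennreal (diameter (U i) powr s) \<le> hausdorff_weight t (U i)"
      proof (cases "U i = {} \<or> diameter (U i) = 0")
        case True
        then show ?thesis using pos by (auto simp: hausdorff_weight_def)
      next
        case False
        then have "diameter (U i) powr s \<le> diameter (U i) powr t"
          using d0[of i] d1[of i] ts by (intro powr_mono') auto
        moreover have "diameter (U i) powr s \<le> 1"
          using d0[of i] d1[of i] pos by (intro powr_le1) auto
        ultimately show ?thesis using False by (simp add: hausdorff_weight_def ennreal_leI)
      qed
      finally show "ennreal (d i powr s) \<le> hausdorff_weight t (U i) + ennreal (e * (1/2) ^ Suc i)"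
        by (simp add: add_right_mono)
    qed auto
    also have "\<dots> = (\<Sum>i. hausdorff_weight t (U i)) + ennreal e"
    proof -
      have "(\<lambda>i. e * (1/2) ^ Suc i) sums (e * 1)" by (intro sums_mult power_half_series)
      then have "(\<Sum>i. ennreal (e * (1/2) ^ Suc i)) = ennreal e"
        using e by (subst suminf_ennreal2) (auto simp: sums_iff)
      then show ?thesis by (subst suminf_add[symmetric]) auto
    qed
    also have "\<dots> \<le> ennreal e + ennreal e" using sum by (intro add_right_mono) auto
    also have "\<dots> = ennreal (2 * e)" using e by (simp flip: ennreal_plus)
    also have "\<dots> < ennreal (a\<^sup>2 / C)" using e by (intro ennreal_lessI) (auto simp: e_def)
    finally show False by simp
  qed
qed

section \<open>Moments and almost sure events\<close>

text \<open>
  Chebyshev's inequality for the deviation \<open>L / 2\<close>. Integrating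
  \<open>L\<^sup>2 / 4 \<cdot> 1\<^bsub>Z < L / 2\<^esub> + 2 L Z \<le> Z\<^sup>2 + L\<^sup>2\<close>, which has no differences, keeps the proof in
  \<open>ennreal\<close>.
\<close>

lemma (in prob_space) prob_lt_half_mean_le:
  fixes Z :: "'a \<Rightarrow> ennreal"
  assumes [measurable]: "Z \<in> borel_measurable M"
    and L: "0 < L" and \<delta>: "0 \<le> \<delta>"
    and mean: "(\<integral>\<^sup>+\<xi>. Z \<xi> \<partial>M) = ennreal L"
    and second: "(\<integral>\<^sup>+\<xi>. Z \<xi> * Z \<xi> \<partial>M) \<le> ennreal (L\<^sup>2 + \<delta>)"
  shows "prob {\<xi> \<in> space M. Z \<xi> < ennreal (L / 2)} \<le> 4 * \<delta> / L\<^sup>2"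
proof -
  define A where "A = {\<xi> \<in> space M. Z \<xi> < ennreal (L / 2)}"
  have [measurable]: "A \<in> sets M" unfolding A_def by measurable
  have pointwise: "ennreal (L\<^sup>2 / 4) * indicator A \<xi> + ennreal (2 * L) * Z \<xi> \<le> Z \<xi> * Z \<xi> + ennreal (L\<^sup>2)"
    if "\<xi> \<in> space M" for \<xi>
  proof (cases "Z \<xi>")
    case (real z)
    have "(if \<xi> \<in> A then L\<^sup>2 / 4 else 0) \<le> (L - z)\<^sup>2"
    proof (cases "\<xi> \<in> A")
      case True
      then have "z < L / 2" using real L by (simp add: A_def ennreal_less_iff)
      then have "(L / 2)\<^sup>2 \<le> (L - z)\<^sup>2" using L by (intro power_mono) auto
      then show ?thesis using True by (simp add: power_divide)
    qed simp
    then have "(if \<xi> \<in> A then L\<^sup>2 / 4 else 0) + 2 * L * z \<le> z * z + L\<^sup>2"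
      by (simp add: power2_eq_square algebra_simps)
    from ennreal_leI[OF this] show ?thesis
      using real L by (cases "\<xi> \<in> A") (simp_all add: ennreal_mult)
  next
    case top
    then show ?thesis by simp
  qed
  have "ennreal (L\<^sup>2 / 4 * prob A + 2 * L * L) = ennreal (L\<^sup>2 / 4 * prob A) + ennreal (2 * L * L)"
    using L by (intro ennreal_plus) auto
  also have "ennreal (L\<^sup>2 / 4 * prob A) = ennreal (L\<^sup>2 / 4) * emeasure M A"
    by (simp only: emeasure_eq_measure ennreal_mult'' measure_nonneg)
  also have "ennreal (2 * L * L) = ennreal (2 * L) * (\<integral>\<^sup>+\<xi>. Z \<xi> \<partial>M)"
    unfolding mean using L by (intro ennreal_mult) auto
  also have "ennreal (L\<^sup>2 / 4) * emeasure M A + ennreal (2 * L) * (\<integral>\<^sup>+\<xi>. Z \<xi> \<partial>M) = (\<integral>\<^sup>+\<xi>. ennreal (L\<^sup>2 / 4) * indicator A \<xi> + ennreal (2 * L) * Z \<xi> \<partial>M)"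
    by (simp add: nn_integral_add nn_integral_cmult)
  also have "\<dots> \<le> (\<integral>\<^sup>+\<xi>. Z \<xi> * Z \<xi> + ennreal (L\<^sup>2) \<partial>M)"
    by (intro nn_integral_mono pointwise)
  also have "\<dots> \<le> ennreal (L\<^sup>2 + \<delta>) + ennreal (L\<^sup>2)"
    using second by (simp add: nn_integral_add emeasure_space_1 add_right_mono)
  also have "\<dots> = ennreal (2 * L * L + \<delta>)"
    using L \<delta> by (simp add: power2_eq_square flip: ennreal_plus)
  finally have "L\<^sup>2 / 4 * prob A \<le> \<delta>"
    using L \<delta> by (subst (asm) ennreal_le_iff) auto
  then show ?thesis using L by (simp add: A_def field_simps)
qed

lemma (in prob_space) prob_gt_le_of_nn_integral:
  fixes Z :: "'a \<Rightarrow> ennreal"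
  assumes [measurable]: "Z \<in> borel_measurable M"
    and C: "0 < C" and \<kappa>: "0 < \<kappa>"
    and mean: "(\<integral>\<^sup>+\<xi>. Z \<xi> \<partial>M) \<le> ennreal C"
  shows "prob {\<xi> \<in> space M. ennreal (C / \<kappa>) < Z \<xi>} \<le> \<kappa>"
proof -
  define A where "A = {\<xi> \<in> space M. ennreal (C / \<kappa>) < Z \<xi>}"
  have [measurable]: "A \<in> sets M" unfolding A_def by measurable
  have "ennreal (C / \<kappa> * prob A) = (\<integral>\<^sup>+\<xi>. ennreal (C / \<kappa>) * indicator A \<xi> \<partial>M)"
    by (simp only: nn_integral_cmult_indicator emeasure_eq_measure ennreal_mult'' measure_nonneg
        \<open>A \<in> sets M\<close>)
  also have "\<dots> \<le> (\<integral>\<^sup>+\<xi>. Z \<xi> \<partial>M)"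
    by (intro nn_integral_mono) (auto simp: A_def split: split_indicator)
  also have "\<dots> \<le> ennreal C" by fact
  finally have "C / \<kappa> * prob A \<le> C" using C by simp
  then show ?thesis using C \<kappa> by (simp add: A_def field_simps)
qed

lemma (in prob_space) prob_infinitely_often_ge:
  fixes A :: "nat \<Rightarrow> 'a set"
  assumes [measurable]: "\<And>n. A n \<in> events" and ge: "\<And>n. c \<le> prob (A n)"
  shows "c \<le> prob {\<xi> \<in> space M. \<forall>n\<^sub>0. \<exists>n\<ge>n\<^sub>0. \<xi> \<in> A n}"
proof -
  define B where "B n\<^sub>0 = (\<Union>n\<in>{n\<^sub>0..}. A n)" for n\<^sub>0
  have [measurable]: "B n \<in> events" for n unfolding B_def by measurable
  have "(\<lambda>n. prob (B n)) \<longlonglongrightarrow> prob (\<Inter>n. B n)"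
    by (intro finite_Lim_measure_decseq) (auto simp: decseq_def B_def intro: order_trans)
  moreover have "c \<le> prob (B n)" for n
    using ge[of n]
    by (rule order_trans) (intro finite_measure_mono \<open>B n \<in> events\<close>, auto simp: B_def)
  ultimately have "c \<le> prob (\<Inter>n. B n)"
    by (intro LIMSEQ_le_const) auto
  also have "(\<Inter>n. B n) = {\<xi> \<in> space M. \<forall>n\<^sub>0. \<exists>n\<ge>n\<^sub>0. \<xi> \<in> A n}"
    using sets.sets_into_space[OF assms(1)] unfolding B_def by blast
  finally show ?thesis .
qed

text \<open>
  The property \<open>P\<close>, later a statement about a Hausdorff dimension, is approximated by measurable
  events from inside only.
\<close>

lemma (in prob_space) AE_of_events_of_prob_near_1:
  assumes "\<And>\<kappa>. 0 < \<kappa> \<Longrightarrow> \<exists>A\<in>events. 1 - \<kappa> \<le> prob A \<and> (\<forall>\<xi>\<in>A. P \<xi>)"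
  shows "AE \<xi> in M. P \<xi>"
proof -
  have "\<forall>j. \<exists>A. A \<in> events \<and> 1 - 1 / real (Suc j) \<le> prob A \<and> (\<forall>\<xi>\<in>A. P \<xi>)"
    using assms[of "1 / real (Suc _)"] by auto
  from choice[OF this] obtain A where A [measurable]: "\<And>j. A j \<in> events"
    and prob: "\<And>j. 1 - 1 / real (Suc j) \<le> prob (A j)" and P: "\<And>j \<xi>. \<xi> \<in> A j \<Longrightarrow> P \<xi>"
    by blast
  have "(\<lambda>j. 1 - 1 / real (Suc j)) \<longlonglongrightarrow> 1 - 0"
    by (intro tendsto_intros LIMSEQ_Suc[OF lim_1_over_n])
  moreover have "1 - 1 / real (Suc j) \<le> prob (\<Union>j. A j)" for j
    using prob[of j] by (rule order_trans) (intro finite_measure_mono, auto)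
  ultimately have "1 - 0 \<le> prob (\<Union>j. A j)" by (intro LIMSEQ_le_const2) auto
  then have "prob (\<Union>j. A j) = 1" using prob_le_1[of "\<Union>j. A j"] by linarith
  then have "AE \<xi> in M. \<xi> \<in> (\<Union>j. A j)" by (subst AE_in_set_eq_1) auto
  then show ?thesis by eventually_elim (auto dest: P)
qed

section \<open>Survival of points under independent stages\<close>

text \<open>
  The law of \<open>W n\<close> is prescribed only inside \<open>{0..1/2}\<close>, where it is Lebesgue measure; the rest of its
  mass is outside of reach of the intervals below, as \<open>\<rho> k \<le> 1/8\<close>.
\<close>

locale random_intervals = prob_space +
  fixes W :: "nat \<Rightarrow> 'a \<Rightarrow> real" and J :: "nat \<Rightarrow> nat set" and \<rho> :: "nat \<Rightarrow> real"
  assumes indep: "indep_vars (\<lambda>_. borel) W (\<Union>k. J k)"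
    and law: "\<And>k n A. n \<in> J k \<Longrightarrow> A \<in> sets borel \<Longrightarrow> A \<subseteq> {0..1/2} \<Longrightarrow>
      prob (W n -` A \<inter> space M) = measure lborel A"
    and finite_block: "\<And>k. finite (J k)"
    and disjoint_blocks: "disjoint_family J"
    and \<rho>_pos: "\<And>k. 0 < \<rho> k" and \<rho>_le: "\<And>k. \<rho> k \<le> 1/8"
begin

lemma rv [measurable]: "n \<in> J k \<Longrightarrow> W n \<in> borel_measurable M"
  using indep unfolding indep_vars_def by auto

abbreviation window :: "real set"
  where "window \<equiv> {1/8..3/8}"

definition hit :: "nat \<Rightarrow> 'a \<Rightarrow> real \<Rightarrow> bool"
  where "hit k \<xi> x \<longleftrightarrow> (\<exists>n\<in>J k. \<bar>W n \<xi> - x\<bar> \<le> \<rho> k)"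

definition p :: "nat \<Rightarrow> real"
  where "p k = 1 - (1 - 2 * \<rho> k) ^ card (J k)"

lemma measurable_hit [measurable (raw)]:
  assumes [measurable]: "f \<in> measurable N M" "g \<in> borel_measurable N"
  shows "Measurable.pred N (\<lambda>z. hit k (f z) (g z))"
proof -
  have [measurable]: "(\<lambda>z. W n (f z)) \<in> borel_measurable N" if "n \<in> J k" for n
    by (rule measurable_compose[OF assms(1) rv[OF that]])
  show ?thesis unfolding hit_def using finite_block[of k] by measurable
qed

lemma prob_avoid:
  assumes A: "A \<in> sets borel" "A \<subseteq> {0..1/2}"
  shows "prob {\<xi> \<in> space M. \<forall>n\<in>J k. W n \<xi> \<notin> A} = (1 - measure lborel A) ^ card (J k)"
proof (cases "J k = {}")
  case True
  then show ?thesis by (simp add: prob_space)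
next
  case False
  have 1: "prob (W n -` (- A) \<inter> space M) = 1 - measure lborel A" if "n \<in> J k" for n
  proof -
    have "W n -` (- A) \<inter> space M = space M - W n -` A \<inter> space M" by auto
    moreover have "W n -` A \<inter> space M \<in> events"
      using rv[OF that] A(1) by (rule measurable_sets)
    ultimately show ?thesis using law[OF that A] by (simp add: prob_compl)
  qed
  have "{\<xi> \<in> space M. \<forall>n\<in>J k. W n \<xi> \<notin> A} = (\<Inter>n\<in>J k. W n -` (- A) \<inter> space M)"
    using False by auto
  also have "prob \<dots> = (\<Prod>n\<in>J k. prob (W n -` (- A) \<inter> space M))"
    using False finite_block A by (intro indep_varsD[OF indep]) auto
  also have "\<dots> = (1 - measure lborel A) ^ card (J k)" using 1 by simp
  finally show ?thesis .
qed

lemma hit_iff: "hit k \<xi> x \<longleftrightarrow> \<not> (\<forall>n\<in>J k. W n \<xi> \<notin> {x - \<rho> k..x + \<rho> k})"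
  unfolding hit_def by (auto simp: abs_le_iff algebra_simps)

lemma prob_not_hit:
  assumes "x \<in> window"
  shows "prob {\<xi> \<in> space M. \<not> hit k \<xi> x} = 1 - p k"
proof -
  have "{x - \<rho> k..x + \<rho> k} \<subseteq> {0..1/2}" using assms \<rho>_le[of k] by auto
  then show ?thesis
    using prob_avoid[of "{x - \<rho> k..x + \<rho> k}" k] \<rho>_pos[of k] by (simp add: hit_iff p_def)
qed

lemma prob_hit:
  assumes "x \<in> window"
  shows "prob {\<xi> \<in> space M. hit k \<xi> x} = p k"
proof -
  have "prob {\<xi> \<in> space M. \<not> hit k \<xi> x} = 1 - prob {\<xi> \<in> space M. hit k \<xi> x}"
    by (intro prob_neg) simp
  then show ?thesis using prob_not_hit[OF assms, of k] by simp
qed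

text \<open>
  Far points have disjoint neighbourhoods, so the probability that all points of the block miss
  both is a power of \<open>1 - 4 \<rho> \<le> (1 - 2 \<rho>)\<^sup>2\<close>: missing \<open>x\<close> and missing \<open>y\<close> are negatively
  correlated. Hence so are hitting \<open>x\<close> and hitting \<open>y\<close>.
\<close>

lemma prob_hit_pair_far:
  assumes x: "x \<in> window" and y: "y \<in> window" and far: "2 * \<rho> k < \<bar>x - y\<bar>"
  shows "prob {\<xi> \<in> space M. hit k \<xi> x \<and> hit k \<xi> y} \<le> (p k)\<^sup>2"
proof -
  define A where "A = {x - \<rho> k..x + \<rho> k} \<union> {y - \<rho> k..y + \<rho> k}"
  have "measure lborel A = measure lborel {x - \<rho> k..x + \<rho> k} + measure lborel {y - \<rho> k..y + \<rho> k}"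
    unfolding A_def using far by (intro measure_Union) (auto simp: emeasure_lborel_Icc_eq)
  then have mA: "measure lborel A = 4 * \<rho> k" using \<rho>_pos[of k] by simp
  have AI: "A \<subseteq> {0..1/2}" unfolding A_def using x y \<rho>_le[of k] by auto
  have "{\<xi> \<in> space M. \<not> hit k \<xi> x \<and> \<not> hit k \<xi> y} = {\<xi> \<in> space M. \<forall>n\<in>J k. W n \<xi> \<notin> A}"
    by (auto simp: hit_iff A_def)
  also have "prob \<dots> = (1 - 4 * \<rho> k) ^ card (J k)"
    using prob_avoid[OF _ AI, of k] mA by (simp add: A_def)
  also have "\<dots> \<le> ((1 - 2 * \<rho> k)\<^sup>2) ^ card (J k)"
    using \<rho>_le[of k] by (intro power_mono) (auto simp: power2_eq_square algebra_simps)
  also have "\<dots> = (1 - p k)\<^sup>2" by (simp add: p_def power_mult[symmetric] mult.commute)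
  finally have neither: "prob {\<xi> \<in> space M. \<not> hit k \<xi> x \<and> \<not> hit k \<xi> y} \<le> (1 - p k)\<^sup>2" .
  have "p k = prob {\<xi> \<in> space M. hit k \<xi> x \<and> hit k \<xi> y} + prob {\<xi> \<in> space M. hit k \<xi> x \<and> \<not> hit k \<xi> y}"
    unfolding prob_hit[OF x, of k, symmetric]
    by (subst finite_measure_Union[symmetric]) (auto intro!: arg_cong[where f=prob])
  moreover have "1 - p k = prob {\<xi> \<in> space M. hit k \<xi> x \<and> \<not> hit k \<xi> y} + prob {\<xi> \<in> space M. \<not> hit k \<xi> x \<and> \<not> hit k \<xi> y}"
    unfolding prob_not_hit[OF y, of k, symmetric]
    by (subst finite_measure_Union[symmetric]) (auto intro!: arg_cong[where f=prob])
  ultimately show ?thesis using neither by (simp add: power2_eq_square algebra_simps)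
qed

text \<open>
  Stages read disjoint blocks of the independent sequence.
\<close>

lemma indep_hits:
  "indep_vars (\<lambda>_. borel) (\<lambda>k \<xi>. indicator {\<xi>. hit k \<xi> x \<and> hit k \<xi> y} \<xi> :: ennreal) UNIV"
proof -
  define \<Phi> :: "nat \<Rightarrow> (nat \<Rightarrow> real) \<Rightarrow> ennreal" where
    "\<Phi> k w = indicator {w. (\<exists>n\<in>J k. \<bar>w n - x\<bar> \<le> \<rho> k) \<and> (\<exists>n\<in>J k. \<bar>w n - y\<bar> \<le> \<rho> k)} w" for k w
  have "indep_vars (\<lambda>k. PiM (J k) (\<lambda>_. borel)) (\<lambda>k \<xi>. restrict (\<lambda>n. W n \<xi>) (J k)) UNIV"
    using disjoint_blocks by (intro indep_vars_restrict[OF indep]) auto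
  moreover have "\<Phi> k \<in> borel_measurable (PiM (J k) (\<lambda>_. borel))" for k
    unfolding \<Phi>_def using finite_block[of k] by measurable
  ultimately have "indep_vars (\<lambda>_. borel) (\<lambda>k \<xi>. \<Phi> k (restrict (\<lambda>n. W n \<xi>) (J k))) UNIV"
    by (rule indep_vars_compose2)
  also have "(\<lambda>k \<xi>. \<Phi> k (restrict (\<lambda>n. W n \<xi>) (J k)))
      = (\<lambda>k \<xi>. indicator {\<xi>. hit k \<xi> x \<and> hit k \<xi> y} \<xi>)"
    by (auto simp: \<Phi>_def hit_def fun_eq_iff split: split_indicator)
  finally show ?thesis .
qed

definition dens :: "nat \<Rightarrow> nat \<Rightarrow> 'a \<Rightarrow> real \<Rightarrow> ennreal"
  where "dens m n \<xi> x =
    (\<Prod>k\<in>{m..<n}. ennreal (1 / p k) * indicator {\<xi>. hit k \<xi> x} \<xi>) * indicator window x"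

lemma measurable_dens [measurable (raw)]:
  assumes [measurable]: "f \<in> measurable N M" "g \<in> borel_measurable N"
  shows "(\<lambda>z. dens m n (f z) (g z)) \<in> borel_measurable N"
  unfolding dens_def by measurable

lemma nn_integral_prod_hits:
  "(\<integral>\<^sup>+\<xi>. (\<Prod>k\<in>{m..<n}. indicator {\<xi>. hit k \<xi> x \<and> hit k \<xi> y} \<xi>) \<partial>M)
    = (\<Prod>k\<in>{m..<n}. ennreal (prob {\<xi> \<in> space M. hit k \<xi> x \<and> hit k \<xi> y}))"
proof -
  have "(\<integral>\<^sup>+\<xi>. (\<Prod>k\<in>{m..<n}. indicator {\<xi>. hit k \<xi> x \<and> hit k \<xi> y} \<xi>) \<partial>M)
    = (\<Prod>k\<in>{m..<n}. \<integral>\<^sup>+\<xi>. indicator {\<xi>. hit k \<xi> x \<and> hit k \<xi> y} \<xi> \<partial>M)"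
    by (intro indep_vars_nn_integral indep_vars_subset[OF indep_hits]) auto
  also have "\<dots> = (\<Prod>k\<in>{m..<n}. ennreal (prob {\<xi> \<in> space M. hit k \<xi> x \<and> hit k \<xi> y}))"
  proof (intro prod.cong refl)
    fix k
    have "(\<integral>\<^sup>+\<xi>. indicator {\<xi>. hit k \<xi> x \<and> hit k \<xi> y} \<xi> \<partial>M)
      = (\<integral>\<^sup>+\<xi>. indicator {\<xi> \<in> space M. hit k \<xi> x \<and> hit k \<xi> y} \<xi> \<partial>M)"
      by (intro nn_integral_cong) (auto split: split_indicator)
    also have "\<dots> = emeasure M {\<xi> \<in> space M. hit k \<xi> x \<and> hit k \<xi> y}"
      by (intro nn_integral_indicator) measurable
    finally show "(\<integral>\<^sup>+\<xi>. indicator {\<xi>. hit k \<xi> x \<and> hit k \<xi> y} \<xi> \<partial>M)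
      = ennreal (prob {\<xi> \<in> space M. hit k \<xi> x \<and> hit k \<xi> y})" by (simp add: emeasure_eq_measure)
  qed
  finally show ?thesis .
qed

lemma nn_integral_dens:
  assumes x: "x \<in> window" and p: "\<And>k. 0 < p k"
  shows "(\<integral>\<^sup>+\<xi>. dens m n \<xi> x \<partial>M) = 1"
proof -
  have "(\<integral>\<^sup>+\<xi>. dens m n \<xi> x \<partial>M) = (\<integral>\<^sup>+\<xi>. (\<Prod>k\<in>{m..<n}. ennreal (1 / p k)) *
      (\<Prod>k\<in>{m..<n}. indicator {\<xi>. hit k \<xi> x \<and> hit k \<xi> x} \<xi>) \<partial>M)"
    using x by (simp add: dens_def prod.distrib)
  also have "\<dots> = (\<Prod>k\<in>{m..<n}. ennreal (1 / p k)) * (\<Prod>k\<in>{m..<n}. ennreal (p k))"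
    by (subst nn_integral_cmult) (measurable, simp add: nn_integral_prod_hits[where x = x and y = x, simplified] prob_hit[OF x])
  also have "\<dots> = (\<Prod>k\<in>{m..<n}. ennreal (1 / p k) * ennreal (p k))" by (rule prod.distrib[symmetric])
  also have "\<dots> = 1"
  proof (intro prod.neutral ballI)
    fix k
    show "ennreal (1 / p k) * ennreal (p k) = 1" using p[of k] by (simp flip: ennreal_mult)
  qed
  finally show ?thesis .
qed

lemma nn_integral_dens_pair_le:
  assumes x: "x \<in> window" and y: "y \<in> window" and p: "\<And>k. 0 < p k"
  shows "(\<integral>\<^sup>+\<xi>. dens m n \<xi> x * dens m n \<xi> y \<partial>M)
    \<le> ennreal (\<Prod>k\<in>{m..<n}. if 2 * \<rho> k < \<bar>x - y\<bar> then 1 else 1 / p k)"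
proof -
  have "(\<integral>\<^sup>+\<xi>. dens m n \<xi> x * dens m n \<xi> y \<partial>M) = (\<integral>\<^sup>+\<xi>. (\<Prod>k\<in>{m..<n}. ennreal (1 / p k) * ennreal (1 / p k)) *
      (\<Prod>k\<in>{m..<n}. indicator {\<xi>. hit k \<xi> x \<and> hit k \<xi> y} \<xi>) \<partial>M)"
  proof (rule nn_integral_cong)
    fix \<xi>
    have "dens m n \<xi> x * dens m n \<xi> y = (\<Prod>k\<in>{m..<n}. (ennreal (1 / p k) * indicator {\<xi>. hit k \<xi> x} \<xi>) *
        (ennreal (1 / p k) * indicator {\<xi>. hit k \<xi> y} \<xi>))"
      using x y by (simp add: dens_def prod.distrib)
    also have "\<dots> = (\<Prod>k\<in>{m..<n}. (ennreal (1 / p k) * ennreal (1 / p k)) * indicator {\<xi>. hit k \<xi> x \<and> hit k \<xi> y} \<xi>)"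
      by (intro prod.cong) (auto split: split_indicator)
    finally show "dens m n \<xi> x * dens m n \<xi> y = (\<Prod>k\<in>{m..<n}. ennreal (1 / p k) * ennreal (1 / p k)) *
      (\<Prod>k\<in>{m..<n}. indicator {\<xi>. hit k \<xi> x \<and> hit k \<xi> y} \<xi>)" by (simp only: prod.distrib)
  qed
  also have "\<dots> = (\<Prod>k\<in>{m..<n}. ennreal (1 / p k) * ennreal (1 / p k)) *
      (\<Prod>k\<in>{m..<n}. ennreal (prob {\<xi> \<in> space M. hit k \<xi> x \<and> hit k \<xi> y}))"
    by (subst nn_integral_cmult) (measurable, simp add: nn_integral_prod_hits)
  also have "\<dots> = (\<Prod>k\<in>{m..<n}. ennreal (1 / p k) * ennreal (1 / p k) *
      ennreal (prob {\<xi> \<in> space M. hit k \<xi> x \<and> hit k \<xi> y}))" by (rule prod.distrib[symmetric])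
  also have "\<dots> \<le> (\<Prod>k\<in>{m..<n}. ennreal (if 2 * \<rho> k < \<bar>x - y\<bar> then 1 else 1 / p k))"
  proof (intro prod_mono_ennreal)
    fix k
    have pk: "0 < p k" by (rule p)
    let ?P = "prob {\<xi> \<in> space M. hit k \<xi> x \<and> hit k \<xi> y}"
    have "?P \<le> prob {\<xi> \<in> space M. hit k \<xi> x}" by (intro finite_measure_mono) auto
    then have "?P \<le> p k" using prob_hit[OF x] by simp
    moreover have "?P \<le> (p k)\<^sup>2" if "2 * \<rho> k < \<bar>x - y\<bar>" using prob_hit_pair_far[OF x y that] .
    ultimately have "1 / p k * (1 / p k) * ?P \<le> (if 2 * \<rho> k < \<bar>x - y\<bar> then 1 else 1 / p k)"
      using pk by (auto simp: field_simps power2_eq_square)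
    from ennreal_leI[OF this]
    show "ennreal (1 / p k) * ennreal (1 / p k) * ennreal ?P
        \<le> ennreal (if 2 * \<rho> k < \<bar>x - y\<bar> then 1 else 1 / p k)"
      using pk by (simp only: ennreal_mult'' measure_nonneg zero_le_divide_1_iff less_imp_le)
  qed
  also have "\<dots> = ennreal (\<Prod>k\<in>{m..<n}. if 2 * \<rho> k < \<bar>x - y\<bar> then 1 else 1 / p k)"
    using p by (intro prod_ennreal) (auto intro: less_imp_le)
  finally show ?thesis .
qed

text \<open>
  Only stages with \<open>2 \<rho> k \<ge> \<bar>u\<bar>\<close> contribute. If \<open>N\<close> is the last of them, there are at most
  \<open>N + 1 - m\<close>, and \<open>\<theta>\<^sup>N \<le> 2 B / \<bar>u\<bar>\<close> turns \<open>(1 / q)\<^sup>N = (\<theta>\<^sup>N)\<^sup>t\<close> into a power of \<open>\<bar>u\<bar>\<close>. The remaining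
  factor \<open>q\<^sup>m\<close> is what makes the variance of the mass small for late starting stages \<open>m\<close>.
\<close>

lemma prod_overlap_le:
  assumes \<theta>: "1 < \<theta>" and q: "0 < q" "q < 1" and pq: "\<And>k. q \<le> p k"
    and B: "0 < B" "\<And>k. \<rho> k \<le> B / \<theta> ^ k" and t: "t = - ln q / ln \<theta>"
  shows "ennreal (\<Prod>k\<in>{m..<n}. if 2 * \<rho> k < \<bar>u\<bar> then 1 else 1 / p k)
    \<le> 1 + ennreal (q ^ m * ((2 * B) powr t / q)) * riesz_kernel t u"
proof (cases "u = 0")
  case True
  then show ?thesis using q B by (simp add: riesz_kernel_def ennreal_mult_top)
next
  case u: False
  have tpos: "0 < t" using \<theta> q by (simp add: t divide_neg_pos)
  define S where "S = {k\<in>{m..<n}. \<not> 2 * \<rho> k < \<bar>u\<bar>}"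
  have finS: "finite S" by (simp add: S_def)
  have prodS: "(\<Prod>k\<in>{m..<n}. if 2 * \<rho> k < \<bar>u\<bar> then 1 else 1 / p k) = (\<Prod>k\<in>S. 1 / p k)"
    unfolding S_def by (subst prod.inter_filter) (auto intro!: prod.cong)
  have bound: "(\<Prod>k\<in>S. 1 / p k) \<le> 1 + q ^ m * ((2 * B) powr t / q) * \<bar>u\<bar> powr - t"
  proof (cases "S = {}")
    case False
    define N where "N = Max S"
    have N: "N \<in> S" using finS False by (simp add: N_def)
    then have mN: "m \<le> N" by (simp add: S_def)
    have "S \<subseteq> {m..N}" using finS by (auto simp: N_def S_def)
    then have cS: "card S \<le> Suc N - m" using card_mono[of "{m..N}" S] by simp
    have "(\<Prod>k\<in>S. 1 / p k) \<le> (\<Prod>k\<in>S. 1 / q)"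
    proof (rule prod_mono)
      fix k
      show "0 \<le> 1 / p k \<and> 1 / p k \<le> 1 / q"
        using pq[of k] q by (auto intro: divide_left_mono)
    qed
    also have "\<dots> = (1 / q) ^ card S" by simp
    also have "\<dots> \<le> (1 / q) ^ (Suc N - m)" using q cS by (intro power_increasing) auto
    also have "\<dots> = q ^ m / q * (1 / q) ^ N"
    proof -
      have "(1 / q) ^ (Suc N - m) * (1 / q) ^ m = (1 / q) ^ Suc N"
        using mN by (simp flip: power_add)
      then show ?thesis using q by (simp add: field_simps)
    qed
    also have "(1 / q) ^ N \<le> (2 * B) powr t * \<bar>u\<bar> powr - t"
    proof -
      have "\<theta> powr t = 1 / q"
        using \<theta> q by (simp add: powr_def t exp_minus inverse_eq_divide)
      then have "(1 / q) ^ N = (\<theta> powr t) powr real N"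
        using q by (simp add: powr_realpow)
      also have "\<dots> = (\<theta> powr real N) powr t" by (simp add: powr_powr mult.commute)
      also have "\<dots> = (\<theta> ^ N) powr t" using \<theta> by (simp add: powr_realpow)
      also have "\<dots> \<le> (2 * B / \<bar>u\<bar>) powr t"
      proof (rule powr_mono2)
        have "\<bar>u\<bar> \<le> 2 * (B / \<theta> ^ N)" using N B(2)[of N] by (simp add: S_def)
        then show "\<theta> ^ N \<le> 2 * B / \<bar>u\<bar>" using \<theta> u by (simp add: field_simps)
      qed (use \<theta> tpos in auto)
      also have "\<dots> = (2 * B) powr t * \<bar>u\<bar> powr - t"
        using B by (simp add: powr_divide powr_minus_divide)
      finally show ?thesis .
    qed
    finally show ?thesis using q by (simp add: field_simps)
  qed (use q B in simp)
  then show ?thesis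
    unfolding prodS using u q B
    by (simp add: riesz_kernel_def ennreal_mult'[symmetric] ennreal_leI flip: ennreal_plus ennreal_1)
qed

section \<open>Mass and energy of the random densities\<close>

definition mass :: "nat \<Rightarrow> nat \<Rightarrow> 'a \<Rightarrow> ennreal"
  where "mass m n \<xi> = (\<integral>\<^sup>+x. dens m n \<xi> x \<partial>lborel)"

definition energy :: "real \<Rightarrow> nat \<Rightarrow> nat \<Rightarrow> 'a \<Rightarrow> ennreal"
  where "energy s m n \<xi> =
    (\<integral>\<^sup>+x. (\<integral>\<^sup>+y. dens m n \<xi> x * dens m n \<xi> y * riesz_kernel s (x - y) \<partial>lborel) \<partial>lborel)"

lemma measurable_mass [measurable]: "mass m n \<in> borel_measurable M"
  unfolding mass_def[abs_def] by measurable

lemma measurable_energy [measurable]: "energy s m n \<in> borel_measurable M"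
  unfolding energy_def[abs_def] by measurable

lemma pair_sigma_finite_lborel: "pair_sigma_finite M (lborel :: real measure)"
  by (intro pair_sigma_finite.intro sigma_finite_measure_axioms lborel.sigma_finite_measure_axioms)

lemma nn_integral_mass:
  assumes p: "\<And>k. 0 < p k"
  shows "(\<integral>\<^sup>+\<xi>. mass m n \<xi> \<partial>M) = ennreal (1/4)"
proof -
  interpret PL: pair_sigma_finite M "lborel :: real measure" by (rule pair_sigma_finite_lborel)
  have "(\<integral>\<^sup>+\<xi>. mass m n \<xi> \<partial>M) = (\<integral>\<^sup>+x. (\<integral>\<^sup>+\<xi>. dens m n \<xi> x \<partial>M) \<partial>lborel)"
    unfolding mass_def by (rule PL.Fubini'[symmetric]) measurable
  also have "\<dots> = (\<integral>\<^sup>+x. indicator window x \<partial>lborel)"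
    using nn_integral_dens p by (intro nn_integral_cong) (auto simp: dens_def split: split_indicator)
  also have "\<dots> = ennreal (1/4)" by simp
  finally show ?thesis .
qed

text \<open>
  Tonelli's theorem, used with \<open>w = 1\<close> for the second moment of the mass and with a Riesz kernel
  for the mean energy.
\<close>

lemma nn_integral_dens_pair_weighted_le:
  fixes w :: "real \<Rightarrow> ennreal"
  assumes [measurable]: "w \<in> borel_measurable borel"
    and pair: "\<And>x y. x \<in> window \<Longrightarrow> y \<in> window \<Longrightarrow>
      (\<integral>\<^sup>+\<xi>. dens m n \<xi> x * dens m n \<xi> y \<partial>M) \<le> 1 + ennreal \<beta> * riesz_kernel t (x - y)"
  shows "(\<integral>\<^sup>+\<xi>. (\<integral>\<^sup>+x. (\<integral>\<^sup>+y. dens m n \<xi> x * dens m n \<xi> y * w (x - y) \<partial>lborel) \<partial>lborel) \<partial>M)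
    \<le> (\<integral>\<^sup>+x\<in>window. (\<integral>\<^sup>+y\<in>window. w (x - y) \<partial>lborel) \<partial>lborel) +
      ennreal \<beta> * (\<integral>\<^sup>+x\<in>window. (\<integral>\<^sup>+y\<in>window. riesz_kernel t (x - y) * w (x - y) \<partial>lborel) \<partial>lborel)"
proof -
  interpret PL: pair_sigma_finite M "lborel :: real measure" by (rule pair_sigma_finite_lborel)
  have "(\<integral>\<^sup>+\<xi>. (\<integral>\<^sup>+x. (\<integral>\<^sup>+y. dens m n \<xi> x * dens m n \<xi> y * w (x - y) \<partial>lborel) \<partial>lborel) \<partial>M)
    = (\<integral>\<^sup>+x. (\<integral>\<^sup>+\<xi>. (\<integral>\<^sup>+y. dens m n \<xi> x * dens m n \<xi> y * w (x - y) \<partial>lborel) \<partial>M) \<partial>lborel)"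
    by (rule PL.Fubini'[symmetric]) measurable
  also have "\<dots> = (\<integral>\<^sup>+x. (\<integral>\<^sup>+y. (\<integral>\<^sup>+\<xi>. dens m n \<xi> x * dens m n \<xi> y * w (x - y) \<partial>M) \<partial>lborel) \<partial>lborel)"
    by (intro nn_integral_cong PL.Fubini'[symmetric]) measurable
  also have "\<dots> \<le> (\<integral>\<^sup>+x. (\<integral>\<^sup>+y. w (x - y) * indicator window y * indicator window x +
      ennreal \<beta> * (riesz_kernel t (x - y) * w (x - y) * indicator window y * indicator window x) \<partial>lborel) \<partial>lborel)"
  proof (intro nn_integral_mono)
    fix x y
    have "(\<integral>\<^sup>+\<xi>. dens m n \<xi> x * dens m n \<xi> y * w (x - y) \<partial>M)
      = (\<integral>\<^sup>+\<xi>. dens m n \<xi> x * dens m n \<xi> y \<partial>M) * w (x - y)"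
      by (rule nn_integral_multc) measurable
    also have "\<dots> \<le> w (x - y) * indicator window y * indicator window x +
      ennreal \<beta> * (riesz_kernel t (x - y) * w (x - y) * indicator window y * indicator window x)"
    proof (cases "x \<in> window \<and> y \<in> window")
      case True
      then show ?thesis using mult_right_mono[OF pair[of x y], of "w (x - y)"]
        by (simp add: distrib_right mult.assoc)
    next
      case False
      then show ?thesis by (auto simp: dens_def)
    qed
    finally show "(\<integral>\<^sup>+\<xi>. dens m n \<xi> x * dens m n \<xi> y * w (x - y) \<partial>M)
      \<le> w (x - y) * indicator window y * indicator window x +
      ennreal \<beta> * (riesz_kernel t (x - y) * w (x - y) * indicator window y * indicator window x)" .
  qed
  also have "\<dots> = (\<integral>\<^sup>+x\<in>window. (\<integral>\<^sup>+y\<in>window. w (x - y) \<partial>lborel) \<partial>lborel) +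
      ennreal \<beta> * (\<integral>\<^sup>+x\<in>window. (\<integral>\<^sup>+y\<in>window. riesz_kernel t (x - y) * w (x - y) \<partial>lborel) \<partial>lborel)"
    by (simp add: nn_integral_add nn_integral_cmult nn_integral_multc)
  finally show ?thesis .
qed

lemma compact_hits: "compact {x\<in>window. \<forall>k\<in>{m..<n}. hit k \<xi> x}"
proof -
  have "closed {x. hit k \<xi> x}" for k
  proof -
    have "{x. hit k \<xi> x} = (\<Union>i\<in>J k. {W i \<xi> - \<rho> k..W i \<xi> + \<rho> k})"
      by (auto simp: hit_def abs_le_iff algebra_simps)
    then show ?thesis using finite_block[of k] by auto
  qed
  then have "compact (window \<inter> (\<Inter>k\<in>{m..<n}. {x. hit k \<xi> x}))"
    by (intro compact_Int_closed closed_INT) auto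
  also have "window \<inter> (\<Inter>k\<in>{m..<n}. {x. hit k \<xi> x}) = {x\<in>window. \<forall>k\<in>{m..<n}. hit k \<xi> x}" by auto
  finally show ?thesis .
qed

lemma dens_eq_0:
  assumes "x \<notin> {x\<in>window. \<forall>k\<in>{m..<n}. hit k \<xi> x}"
  shows "dens m n \<xi> x = 0"
  using assms by (auto simp: dens_def indicator_def intro!: prod_zero)

text \<open>
  The second moment argument. The starting stage \<open>m\<close> depends on the admitted failure probability
  \<open>\<kappa>\<close>, half of which is spent on the mass and half on the energy; both bounds are uniform in \<open>n\<close>,
  so they hold simultaneously for infinitely many \<open>n\<close> with probability at least \<open>1 - \<kappa>\<close>.
\<close>

theorem AE_hausdorff_dim_hits_ge:
  assumes \<theta>: "1 < \<theta>" and q: "0 < q" "q < 1" and pq: "\<And>k. q \<le> p k"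
    and B: "0 < B" "\<And>k. \<rho> k \<le> B / \<theta> ^ k"
    and s: "0 < s" "s + (- ln q / ln \<theta>) < 1"
  shows "AE \<xi> in M. \<exists>m. ereal s \<le> hausdorff_dim {x\<in>window. \<forall>k\<ge>m. hit k \<xi> x}"
proof (rule AE_of_events_of_prob_near_1)
  fix \<kappa> :: real assume \<kappa>: "0 < \<kappa>"
  define t where "t = - ln q / ln \<theta>"
  have tpos: "0 < t" using \<theta> q by (simp add: t_def divide_neg_pos)
  define R where "R a = (\<integral>\<^sup>+x\<in>window. (\<integral>\<^sup>+y\<in>window. riesz_kernel a (x - y) \<partial>lborel) \<partial>lborel)" for a
  have R: "\<exists>r\<ge>0. R a = ennreal r" if "0 \<le> a" "a < 1" for a
    using nn_integral_riesz_kernel_finite[OF that, of "1/8" "3/8"] unfolding R_def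
    by (cases rule: ennreal_cases) auto
  obtain rt where rt: "0 \<le> rt" "R t = ennreal rt" using R[of t] s tpos by (auto simp: t_def)
  obtain rs where rs: "0 \<le> rs" "R s = ennreal rs" using R[of s] s tpos by (auto simp: t_def)
  obtain rst where rst: "0 \<le> rst" "R (t + s) = ennreal rst" using R[of "t + s"] s tpos by (auto simp: t_def)
  define G where "G = (2 * B) powr t / q"
  have G: "0 < G" using B q by (simp add: G_def)
  have "(\<lambda>m. 64 * (q ^ m * G * rt)) \<longlonglongrightarrow> 64 * (0 * G * rt)"
    using q by (intro tendsto_intros LIMSEQ_realpow_zero) auto
  then have "eventually (\<lambda>m. 64 * (q ^ m * G * rt) < \<kappa> / 2) sequentially"
    using \<kappa> by (intro order_tendstoD(2)[where y = "64 * (0 * G * rt)"]) auto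
  then obtain m where m_small: "64 * (q ^ m * G * rt) < \<kappa> / 2"
    by (auto simp: eventually_sequentially)
  define \<beta> where "\<beta> = q ^ m * G"
  have \<beta>: "0 < \<beta>" using q G by (simp add: \<beta>_def)
  have p0: "0 < p k" for k using pq[of k] q by simp
  have pair: "(\<integral>\<^sup>+\<xi>. dens m n \<xi> x * dens m n \<xi> y \<partial>M) \<le> 1 + ennreal \<beta> * riesz_kernel t (x - y)"
    if "x \<in> window" "y \<in> window" for x y n
    using nn_integral_dens_pair_le[OF that p0, where m = m and n = n]
      prod_overlap_le[OF \<theta> q pq B t_def, where m = m and n = n and u = "x - y"]
    unfolding \<beta>_def G_def by (simp add: order_trans)
  have second: "(\<integral>\<^sup>+\<xi>. mass m n \<xi> * mass m n \<xi> \<partial>M) \<le> ennreal ((1/4)\<^sup>2 + \<beta> * rt)" for n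
  proof -
    have "(\<integral>\<^sup>+\<xi>. mass m n \<xi> * mass m n \<xi> \<partial>M)
      = (\<integral>\<^sup>+\<xi>. (\<integral>\<^sup>+x. (\<integral>\<^sup>+y. dens m n \<xi> x * dens m n \<xi> y * 1 \<partial>lborel) \<partial>lborel) \<partial>M)"
      by (intro nn_integral_cong) (simp add: mass_def nn_integral_cmult nn_integral_multc)
    also have "\<dots> \<le> (\<integral>\<^sup>+x\<in>window. (\<integral>\<^sup>+y\<in>window. 1 \<partial>lborel) \<partial>lborel) + ennreal \<beta> * R t"
      using nn_integral_dens_pair_weighted_le[of "\<lambda>_. 1" m n \<beta> t] pair by (simp add: R_def)
    also have "(\<integral>\<^sup>+x\<in>window. (\<integral>\<^sup>+y\<in>window. 1 \<partial>lborel) \<partial>lborel) = ennreal ((1/4)\<^sup>2)"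
      by (simp add: nn_integral_cmult power2_eq_square flip: ennreal_mult)
    also have "ennreal ((1/4)\<^sup>2) + ennreal \<beta> * R t = ennreal ((1/4)\<^sup>2) + ennreal (\<beta> * rt)"
      using rt \<beta> by (simp add: ennreal_mult)
    also have "\<dots> = ennreal ((1/4)\<^sup>2 + \<beta> * rt)"
      using rt \<beta> by (intro ennreal_plus[symmetric]) auto
    finally show ?thesis .
  qed
  \<comment> \<open>the summand \<open>1\<close> only ensures that \<open>E\<close> is positive\<close>
  define E where "E = rs + \<beta> * rst + 1"
  have E: "0 < E" using rs rst \<beta> by (simp add: E_def add_nonneg_pos)
  have first_energy: "(\<integral>\<^sup>+\<xi>. energy s m n \<xi> \<partial>M) \<le> ennreal E" for n
  proof -
    have "(\<integral>\<^sup>+\<xi>. energy s m n \<xi> \<partial>M) \<le> R s + ennreal \<beta> * R (t + s)"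
      using nn_integral_dens_pair_weighted_le[of "riesz_kernel s" m n \<beta> t] pair
      by (simp add: R_def energy_def riesz_kernel_mult)
    also have "\<dots> = ennreal (rs + \<beta> * rst)" using rs rst \<beta> by (simp add: ennreal_mult)
    also have "\<dots> \<le> ennreal E" by (intro ennreal_leI) (simp add: E_def)
    finally show ?thesis .
  qed
  define A where "A n = {\<xi> \<in> space M. ennreal (1/8) \<le> mass m n \<xi> \<and> energy s m n \<xi> \<le> ennreal (E / (\<kappa> / 2))}" for n
  have A_events: "A n \<in> events" for n unfolding A_def by measurable
  have A_prob: "1 - \<kappa> \<le> prob (A n)" for n
  proof -
    have "prob {\<xi> \<in> space M. mass m n \<xi> < ennreal (1/8)} \<le> \<kappa> / 2"
      using prob_lt_half_mean_le[OF _ _ _ nn_integral_mass[OF p0] second[of n]] rt \<beta> m_small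
      by (simp add: \<beta>_def power2_eq_square)
    moreover have "prob {\<xi> \<in> space M. ennreal (E / (\<kappa> / 2)) < energy s m n \<xi>} \<le> \<kappa> / 2"
      using \<kappa> by (intro prob_gt_le_of_nn_integral E first_energy) auto
    moreover have "prob (space M - A n) \<le> prob {\<xi> \<in> space M. mass m n \<xi> < ennreal (1/8)} +
        prob {\<xi> \<in> space M. ennreal (E / (\<kappa> / 2)) < energy s m n \<xi>}"
      by (rule order_trans[OF finite_measure_mono measure_Un_le])
        (auto simp: A_def not_le)
    ultimately show ?thesis using prob_compl[OF A_events[of n]] by simp
  qed
  show "\<exists>A\<in>events. 1 - \<kappa> \<le> prob A \<and> (\<forall>\<xi>\<in>A. \<exists>m. ereal s \<le> hausdorff_dim {x\<in>window. \<forall>k\<ge>m. hit k \<xi> x})"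
  proof (intro bexI conjI ballI)
    show "{\<xi> \<in> space M. \<forall>n\<^sub>0. \<exists>n\<ge>n\<^sub>0. \<xi> \<in> A n} \<in> events" using A_events by measurable
    show "1 - \<kappa> \<le> prob {\<xi> \<in> space M. \<forall>n\<^sub>0. \<exists>n\<ge>n\<^sub>0. \<xi> \<in> A n}"
      by (rule prob_infinitely_often_ge[OF A_events A_prob])
    fix \<xi> assume \<xi>: "\<xi> \<in> {\<xi> \<in> space M. \<forall>n\<^sub>0. \<exists>n\<ge>n\<^sub>0. \<xi> \<in> A n}"
    define K where "K n = {x\<in>window. \<forall>k\<in>{m..<n}. hit k \<xi> x}" for n
    have "ereal s \<le> hausdorff_dim (\<Inter>n. K n)"
    proof (rule hausdorff_dim_ge_of_energy)
      show "compact (K n)" for n unfolding K_def by (rule compact_hits)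
      show "decseq K" by (auto simp: decseq_def K_def)
      show "0 < (1/8 :: real)" "0 < E / (\<kappa> / 2)" "0 < s" using E \<kappa> s by auto
      fix n\<^sub>0
      obtain n where n: "n\<^sub>0 \<le> n" "\<xi> \<in> A n" using \<xi> by blast
      show "\<exists>n\<ge>n\<^sub>0. \<exists>f\<in>borel_measurable borel. (\<forall>x. x \<notin> K n \<longrightarrow> f x = 0) \<and>
        ennreal (1/8) \<le> (\<integral>\<^sup>+x. f x \<partial>lborel) \<and>
        (\<integral>\<^sup>+x. (\<integral>\<^sup>+y. f x * f y * riesz_kernel s (x - y) \<partial>lborel) \<partial>lborel) \<le> ennreal (E / (\<kappa> / 2))"
      proof (intro exI[of _ n] conjI n(1) bexI[of _ "dens m n \<xi>"])
        show "\<forall>x. x \<notin> K n \<longrightarrow> dens m n \<xi> x = 0" using dens_eq_0 by (auto simp: K_def)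
        show "ennreal (1/8) \<le> (\<integral>\<^sup>+x. dens m n \<xi> x \<partial>lborel)"
          using n(2) by (simp add: A_def mass_def)
        show "(\<integral>\<^sup>+x. (\<integral>\<^sup>+y. dens m n \<xi> x * dens m n \<xi> y * riesz_kernel s (x - y) \<partial>lborel) \<partial>lborel) \<le> ennreal (E / (\<kappa> / 2))"
          using n(2) by (simp add: A_def energy_def)
        have "\<xi> \<in> space M" using \<xi> by simp
        then show "dens m n \<xi> \<in> borel_measurable borel" by measurable
      qed
    qed
    also have "(\<Inter>n. K n) = {x\<in>window. \<forall>k\<ge>m. hit k \<xi> x}"
    proof (intro set_eqI iffI)
      fix x assume "x \<in> (\<Inter>n. K n)"
      then have x: "x \<in> K (Suc k)" for k by blast
      have "hit k \<xi> x" if "m \<le> k" for k using x[of k] that by (simp add: K_def)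
      then show "x \<in> {x\<in>window. \<forall>k\<ge>m. hit k \<xi> x}" using x[of 0] by (simp add: K_def)
    qed (auto simp: K_def)
    finally show "\<exists>m. ereal s \<le> hausdorff_dim {x\<in>window. \<forall>k\<ge>m. hit k \<xi> x}" by blast
  qed
qed

end

section \<open>A coordinate on an arc of the torus\<close>

lemma torus_norm_to_torus:
  assumes "\<bar>u\<bar> \<le> 1/2"
  shows "torus_norm (to_torus u) = \<bar>u\<bar>"
proof -
  have "\<bar>u\<bar> \<le> \<bar>u - of_int (round u)\<bar>"
    using assms by (cases "round u = 0") linarith+
  then show ?thesis using torus_norm_to_torus_le[of u] by (simp add: torus_norm.abs_eq)
qed

lemma dist_to_torus: "dist (to_torus x) (to_torus y) = torus_norm (to_torus (x - y))"
  by (simp add: dist_torus_def minus_torus.abs_eq)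

lemma torus_representative:
  obtains x where "0 \<le> x" "x < 1" "z = to_torus x"
proof -
  have "\<exists>r. z = to_torus r" by (induct z rule: torus.abs_induct) auto
  then obtain r where r: "z = to_torus r" ..
  have "to_torus r = to_torus (frac r)"
    by (simp add: torus.abs_eq_iff frac_def)
  then show ?thesis using r that[of "frac r"] by (simp add: frac_lt_1)
qed

text \<open>
  The distance to \<open>0\<close> is a coordinate on the arc of radius \<open>1/4\<close> around \<open>1/4\<close>, the image of
  \<open>{0..1/2}\<close>. Unlike a choice of representatives it is evidently a Borel function. The value \<open>2\<close> is
  a marker for points off the arc, at distance more than \<open>1/8\<close> from \<open>{0..1/2}\<close>.
\<close>

definition arc_coord :: "torus \<Rightarrow> real"
  where "arc_coord z = (if dist z (to_torus (1/4)) \<le> 1/4 then dist z (to_torus 0) else 2)"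

lemma measurable_arc_coord [measurable]: "arc_coord \<in> borel_measurable borel"
proof -
  have [measurable]: "(\<lambda>z. dist z w) \<in> borel_measurable borel" for w :: torus
    by (intro borel_measurable_continuous_onI continuous_intros)
  show ?thesis unfolding arc_coord_def[abs_def] by measurable
qed

lemma arc_coord_to_torus:
  assumes "0 \<le> x" "x < 1"
  shows "arc_coord (to_torus x) = (if x \<le> 1/2 then x else 2)"
proof (cases "x \<le> 1/2")
  case True
  then have "\<bar>x - 1/4\<bar> \<le> 1/4" "\<bar>x - 0\<bar> \<le> 1/2" using assms by linarith+
  then show ?thesis
    using True assms torus_norm_to_torus[of "x - 1/4"] torus_norm_to_torus[of "x - 0"]
    by (simp add: arc_coord_def dist_to_torus)
next
  case False
  have "real_of_int (round (x - 1/4)) \<le> 0 \<or> 1 \<le> real_of_int (round (x - 1/4))"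
    by (cases "round (x - 1/4) \<le> 0") auto
  then have "1/4 < \<bar>x - 1/4 - of_int (round (x - 1/4))\<bar>"
    using False assms by auto
  then show ?thesis using False by (simp add: arc_coord_def dist_to_torus torus_norm.abs_eq)
qed

lemma to_torus_arc_coord: "arc_coord z \<le> 1/2 \<Longrightarrow> to_torus (arc_coord z) = z"
  by (rule torus_representative[of z]) (auto simp: arc_coord_to_torus split: if_splits)

lemma measure_arc_coord_vimage:
  assumes X: "X \<in> measurable M borel" "distr M borel X = torus_uniform"
    and A: "A \<in> sets borel" "A \<subseteq> {0..1/2}"
  shows "measure M ((\<lambda>\<xi>. arc_coord (X \<xi>)) -` A \<inter> space M) = measure lborel A"
proof -
  have S: "arc_coord -` A \<in> sets borel"
    using measurable_sets[OF measurable_arc_coord A(1)] by simp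
  have "measure M ((\<lambda>\<xi>. arc_coord (X \<xi>)) -` A \<inter> space M) = measure (distr M borel X) (arc_coord -` A)"
    by (simp only: measure_distr[OF X(1) S] vimage_comp comp_def)
  also have "\<dots> = measure (uniform_measure lborel {0..<1}) (to_torus -` (arc_coord -` A))"
    unfolding X(2) torus_uniform_def using S by (subst measure_distr) simp_all
  also have "\<dots> = measure lborel ({0..<1} \<inter> to_torus -` (arc_coord -` A)) / measure lborel {0..<1::real}"
    using measurable_sets[OF measurable_to_torus S] by (subst measure_uniform_measure) auto
  also have "{0..<1} \<inter> to_torus -` (arc_coord -` A) = A"
    using A(2) by (auto simp: arc_coord_to_torus subset_iff split: if_splits)
  finally show ?thesis by simp
qed

section \<open>Blocks of geometric length\<close>

lemma hausdorff_dim_nonneg: "0 \<le> hausdorff_dim A"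
  unfolding hausdorff_dim_def by (auto intro!: INF_greatest)

text \<open>
  For \<open>N\<^bsub>k+1\<^esub> \<le> R < N\<^bsub>k+2\<^esub>\<close> all points of block \<open>k\<close> have index at most \<open>R\<close>, while \<open>c / R\<close> is strictly
  larger than the radius of stage \<open>k\<close>.
\<close>

lemma mem_uniform_cover_set_of_blocks:
  fixes N :: "nat \<Rightarrow> nat"
  assumes c: "0 < c" and mono: "mono N" and unbounded: "\<And>R. \<exists>k. R < N k" and pos: "\<And>k. 0 < N k"
    and hit: "\<And>k. m \<le> k \<Longrightarrow> \<exists>n\<in>{N k<..N (Suc k)}. torus_norm (w n - y) \<le> c / real (N (k + 2))"
  shows "y \<in> uniform_cover_set (\<lambda>n. c / real n) w"
  unfolding uniform_cover_set_def
proof (rule CollectI, rule exI[of _ "N (Suc m)"], rule allI, rule impI)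
  fix R assume R: "N (Suc m) \<le> R"
  define j where "j = (LEAST k. R < N k)"
  have j: "R < N j" unfolding j_def using unbounded by (rule LeastI_ex)
  have "Suc m < j"
  proof (rule ccontr)
    assume "\<not> Suc m < j"
    then have "N j \<le> N (Suc m)" by (intro monoD[OF mono]) simp
    then show False using R j by simp
  qed
  then obtain k where k: "j = k + 2" "m \<le> k" by (intro that[of "j - 2"]) auto
  have "\<not> R < N (Suc k)"
    using not_less_Least[of "Suc k" "\<lambda>k. R < N k"] k(1) by (simp add: j_def)
  then have NR: "N (Suc k) \<le> R" by simp
  obtain n where n: "n \<in> {N k<..N (Suc k)}" "torus_norm (w n - y) \<le> c / real (N (k + 2))"
    using hit[OF k(2)] by blast
  have "c / real (N (k + 2)) < c / real R"
    using c j k(1) pos[of "Suc k"] NR by (intro divide_strict_left_mono) auto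
  then have "1 \<le> n \<and> n \<le> R \<and> torus_norm (w n - y) < c / real R"
    using n NR by simp
  then show "\<exists>n. 1 \<le> n \<and> n \<le> R \<and> torus_norm (w n - y) < c / real R" ..
qed

lemma power_le_exp_neg:
  fixes x :: real
  assumes "0 \<le> x" "x \<le> 1"
  shows "(1 - x) ^ n \<le> exp (- (x * real n))"
proof -
  have "(1 - x) ^ n \<le> exp (- x) ^ n"
    using assms exp_ge_add_one_self[of "- x"] by (intro power_mono) auto
  then show ?thesis by (simp add: exp_of_nat_mult[symmetric] mult.commute)
qed

text \<open>
  The limit is the expected number of points of a block that hit a given point; the summands \<open>1\<close>
  account for rounding \<open>\<theta>\<^sup>k\<close> up to an integer.
\<close>

lemma block_intensity_tendsto:
  fixes \<theta> :: real
  assumes "1 < \<theta>"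
  shows "(\<lambda>k. 2 * (c / (\<theta> ^ (k + 2) + 1)) * (\<theta> ^ (k + 1) - (\<theta> ^ k + 1)))
    \<longlonglongrightarrow> 2 * c * ((\<theta> - 1) / \<theta>\<^sup>2)"
proof -
  have "(\<lambda>k. 2 * (c / (\<theta>\<^sup>2 + (1 / \<theta>) ^ k)) * (\<theta> - (1 + (1 / \<theta>) ^ k)))
    \<longlonglongrightarrow> 2 * (c / (\<theta>\<^sup>2 + 0)) * (\<theta> - (1 + 0))"
    using assms by (intro tendsto_intros LIMSEQ_realpow_zero) auto
  moreover have "2 * (c / (\<theta>\<^sup>2 + (1 / \<theta>) ^ k)) * (\<theta> - (1 + (1 / \<theta>) ^ k))
    = 2 * (c / (\<theta> ^ (k + 2) + 1)) * (\<theta> ^ (k + 1) - (\<theta> ^ k + 1))" for k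
  proof -
    have "\<theta> ^ (k + 2) + 1 = \<theta> ^ k * (\<theta>\<^sup>2 + (1 / \<theta>) ^ k)"
      "\<theta> ^ (k + 1) - (\<theta> ^ k + 1) = \<theta> ^ k * (\<theta> - (1 + (1 / \<theta>) ^ k))"
      using assms by (simp_all add: power_add power_one_over power2_eq_square algebra_simps)
    then show ?thesis using assms by simp
  qed
  ultimately show ?thesis using assms by simp
qed

text \<open>
  A strict inequality for \<open>s\<close> leaves room for a number \<open>q < P\<close> with \<open>s + t < 1\<close>, where
  \<open>\<theta>\<^sup>t = 1 / q\<close>; discarding the first \<open>k\<^sub>0\<close> stages, every stage is survived with probability at
  least \<open>q\<close> and has radius at most \<open>1/8\<close>.
\<close>

lemma AE_hausdorff_dim_uniform_cover_set_ge_of_less: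
  fixes M :: "'a measure" and \<omega> :: "nat \<Rightarrow> 'a \<Rightarrow> torus"
  assumes M: "prob_space M"
    and ind: "prob_space.indep_vars M (\<lambda>_. borel) \<omega> {1..}"
    and unif: "\<And>n. n \<ge> 1 \<Longrightarrow> distr M borel (\<omega> n) = torus_uniform"
    and c: "0 < c" and \<theta>: "1 < \<theta>" and s: "0 < s"
    and s_less: "s < 1 - (- ln (1 - exp (- 2 * c * ((\<theta> - 1) / \<theta>\<^sup>2)))) / ln \<theta>"
  shows "AE \<xi> in M. ereal s \<le> hausdorff_dim (uniform_cover_set (\<lambda>n. c / real n) (\<lambda>n. \<omega> n \<xi>))"
proof -
  interpret prob_space M by fact
  define a where "a = 2 * c * ((\<theta> - 1) / \<theta>\<^sup>2)"
  have a: "0 < a" using c \<theta> by (simp add: a_def)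
  define P where "P = 1 - exp (- a)"
  have P: "0 < P" "P < 1" using a by (auto simp: P_def)
  have "exp ((s - 1) * ln \<theta>) < P"
  proof -
    have "s < 1 - (- ln P) / ln \<theta>" using s_less by (simp add: P_def a_def)
    then have "(s - 1) * ln \<theta> < ln P" using \<theta> by (simp add: field_simps)
    then have "exp ((s - 1) * ln \<theta>) < exp (ln P)" by simp
    then show ?thesis using P by simp
  qed
  then obtain q where q: "exp ((s - 1) * ln \<theta>) < q" "q < P" using dense by blast
  have q01: "0 < q" "q < 1" using q P exp_gt_zero[of "(s - 1) * ln \<theta>"] by linarith+
  have "(s - 1) * ln \<theta> < ln q" using q(1) q01 by (metis exp_less_cancel_iff exp_ln)
  then have sq: "s + (- ln q / ln \<theta>) < 1" using \<theta> by (simp add: field_simps)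
  have "- ln (1 - q) < a"
  proof -
    have "exp (- a) < 1 - q" using q(2) by (simp add: P_def)
    then have "- a < ln (1 - q)" using q01 by (metis exp_less_cancel_iff exp_ln diff_gt_0_iff_gt)
    then show ?thesis by simp
  qed
  then have "eventually (\<lambda>k. - ln (1 - q) < 2 * (c / (\<theta> ^ (k + 2) + 1)) * (\<theta> ^ (k + 1) - (\<theta> ^ k + 1))) sequentially"
    using block_intensity_tendsto[OF \<theta>, of c] unfolding a_def by (intro order_tendstoD)
  moreover have "eventually (\<lambda>k. c * (1 / \<theta>) ^ k < 1/8) sequentially"
  proof -
    have "(\<lambda>k. c * (1 / \<theta>) ^ k) \<longlonglongrightarrow> c * 0"
      using \<theta> by (intro tendsto_intros LIMSEQ_realpow_zero) auto
    then show ?thesis by (intro order_tendstoD(2)[where y = "c * 0"]) auto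
  qed
  ultimately have "eventually (\<lambda>k. - ln (1 - q) < 2 * (c / (\<theta> ^ (k + 2) + 1)) * (\<theta> ^ (k + 1) - (\<theta> ^ k + 1))
      \<and> c * (1 / \<theta>) ^ k < 1/8) sequentially" by (rule eventually_conj)
  then obtain k\<^sub>0 where k0: "\<And>k. k\<^sub>0 \<le> k \<Longrightarrow> - ln (1 - q) < 2 * (c / (\<theta> ^ (k + 2) + 1)) * (\<theta> ^ (k + 1) - (\<theta> ^ k + 1))"
    "\<And>k. k\<^sub>0 \<le> k \<Longrightarrow> c * (1 / \<theta>) ^ k < 1/8"
    unfolding eventually_sequentially by blast
  define N where "N k = nat \<lceil>\<theta> ^ (k\<^sub>0 + k)\<rceil>" for k
  have N_bounds: "\<theta> ^ (k\<^sub>0 + k) \<le> real (N k)" "real (N k) \<le> \<theta> ^ (k\<^sub>0 + k) + 1" for k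
  proof -
    have "0 \<le> \<lceil>\<theta> ^ (k\<^sub>0 + k)\<rceil>" using \<theta> by (simp add: zero_le_ceiling less_le_trans[of "-1" 0])
    then have "real (N k) = of_int \<lceil>\<theta> ^ (k\<^sub>0 + k)\<rceil>" by (simp add: N_def)
    then show "\<theta> ^ (k\<^sub>0 + k) \<le> real (N k)" "real (N k) \<le> \<theta> ^ (k\<^sub>0 + k) + 1" by linarith+
  qed
  have N_pos: "0 < N k" for k
    using N_bounds(1)[of k] \<theta> by (metis less_le_trans of_nat_0_less_iff zero_less_one zero_less_power order_less_trans)
  have N_mono: "mono N"
    using \<theta> unfolding N_def by (intro monoI nat_mono ceiling_mono power_increasing) auto
  have N_unbounded: "\<exists>k. R < N k" for R
  proof -
    obtain k where "real R < \<theta> ^ k" using real_arch_pow[OF \<theta>] by blast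
    also have "\<theta> ^ k \<le> \<theta> ^ (k\<^sub>0 + k)" using \<theta> by (intro power_increasing) auto
    also have "\<dots> \<le> real (N k)" by (rule N_bounds)
    finally show ?thesis by auto
  qed
  define J where "J k = {N k<..N (Suc k)}" for k
  define \<rho> where "\<rho> k = c / real (N (k + 2))" for k
  define W where "W n \<xi> = arc_coord (\<omega> n \<xi>)" for n \<xi>
  have J_sub: "(\<Union>k. J k) \<subseteq> {1..}" by (auto simp: J_def)
  have \<rho>_decay: "\<rho> k \<le> c / \<theta> ^ (k\<^sub>0 + k)" for k
  proof -
    have "\<theta> ^ (k\<^sub>0 + k) \<le> \<theta> ^ (k\<^sub>0 + (k + 2))" using \<theta> by (intro power_increasing) auto
    also have "\<dots> \<le> real (N (k + 2))" by (rule N_bounds)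
    finally show ?thesis
      unfolding \<rho>_def using c \<theta> N_pos[of "k + 2"] by (intro divide_left_mono mult_pos_pos) auto
  qed
  interpret random_intervals M W J \<rho>
  proof
    have "indep_vars (\<lambda>_. borel) W {1..}"
      unfolding W_def[abs_def] by (rule indep_vars_compose2[OF ind]) simp
    then show "indep_vars (\<lambda>_. borel) W (\<Union>k. J k)" using J_sub by (rule indep_vars_subset)
    show "prob (W n -` A \<inter> space M) = measure lborel A"
      if "n \<in> J k" "A \<in> sets borel" "A \<subseteq> {0..1/2}" for k n A
    proof -
      have n: "1 \<le> n" using J_sub that by auto
      then have "\<omega> n \<in> borel_measurable M" using ind by (auto simp: indep_vars_def)
      then show ?thesis
        using measure_arc_coord_vimage[OF _ unif[OF n] that(2,3)] by (simp add: W_def[abs_def])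
    qed
    show "finite (J k)" for k by (simp add: J_def)
    show "disjoint_family J"
    proof -
      have "J k \<inter> J l = {}" if "k < l" for k l
        using monoD[OF N_mono, of "Suc k" l] that by (auto simp: J_def)
      then have "J k \<inter> J l = {}" if "k \<noteq> l" for k l
        using that by (cases k l rule: linorder_cases) (auto simp: Int_commute)
      then show ?thesis by (simp add: disjoint_family_on_def)
    qed
    show "0 < \<rho> k" for k using c N_pos by (simp add: \<rho>_def)
    show "\<rho> k \<le> 1/8" for k
    proof -
      have "c / \<theta> ^ (k\<^sub>0 + k) < 1/8" using k0(2)[of "k\<^sub>0 + k"] by (simp add: power_one_over)
      then show ?thesis using \<rho>_decay[of k] by linarith
    qed
  qed
  have "q \<le> p k" for k
  proof -
    have "- ln (1 - q) < 2 * (c / (\<theta> ^ (k\<^sub>0 + k + 2) + 1)) * (\<theta> ^ (k\<^sub>0 + k + 1) - (\<theta> ^ (k\<^sub>0 + k) + 1))"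
      by (rule k0) simp
    moreover have "0 < - ln (1 - q)" using q01 by simp
    ultimately have "0 < 2 * (c / (\<theta> ^ (k\<^sub>0 + k + 2) + 1)) * (\<theta> ^ (k\<^sub>0 + k + 1) - (\<theta> ^ (k\<^sub>0 + k) + 1))"
      by (rule order_less_trans[rotated])
    moreover have dpos: "0 < \<theta> ^ (k\<^sub>0 + k + 2) + 1" using \<theta> by (intro add_pos_pos zero_less_power) auto
    then have "0 < 2 * (c / (\<theta> ^ (k\<^sub>0 + k + 2) + 1))" using c by simp
    ultimately have gap: "0 < \<theta> ^ (k\<^sub>0 + k + 1) - (\<theta> ^ (k\<^sub>0 + k) + 1)"
      by (rule zero_less_mult_pos)
    have "- ln (1 - q) < 2 * (c / (\<theta> ^ (k\<^sub>0 + k + 2) + 1)) * (\<theta> ^ (k\<^sub>0 + k + 1) - (\<theta> ^ (k\<^sub>0 + k) + 1))"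
      by (rule k0) simp
    also have "\<dots> \<le> 2 * \<rho> k * real (card (J k))"
    proof (rule mult_mono)
      show "2 * (c / (\<theta> ^ (k\<^sub>0 + k + 2) + 1)) \<le> 2 * \<rho> k"
      proof -
        have "real (N (k + 2)) \<le> \<theta> ^ (k\<^sub>0 + k + 2) + 1"
          using N_bounds(2)[of "k + 2"] by (simp only: add.assoc)
        then have "c / (\<theta> ^ (k\<^sub>0 + k + 2) + 1) \<le> \<rho> k"
          unfolding \<rho>_def using c N_pos[of "k + 2"] dpos
          by (intro divide_left_mono mult_pos_pos) simp_all
        then show ?thesis by simp
      qed
      have "real (card (J k)) = real (N (Suc k)) - real (N k)"
        using monoD[OF N_mono, of k "Suc k"] by (simp add: J_def of_nat_diff)
      then show "\<theta> ^ (k\<^sub>0 + k + 1) - (\<theta> ^ (k\<^sub>0 + k) + 1) \<le> real (card (J k))"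
        using N_bounds(1)[of "Suc k"] N_bounds(2)[of k] by simp
    qed (use \<rho>_pos[of k] gap in auto)
    finally have "exp (- (2 * \<rho> k * real (card (J k)))) \<le> exp (ln (1 - q))" by simp
    moreover have "(1 - 2 * \<rho> k) ^ card (J k) \<le> exp (- (2 * \<rho> k * real (card (J k))))"
      using \<rho>_pos[of k] \<rho>_le[of k] by (intro power_le_exp_neg) auto
    ultimately show ?thesis using q01 by (simp add: p_def)
  qed
  moreover have "\<rho> k \<le> c / \<theta> ^ k" for k
  proof -
    have "\<theta> ^ k \<le> \<theta> ^ (k\<^sub>0 + k)" using \<theta> by (intro power_increasing) auto
    then have "c / \<theta> ^ (k\<^sub>0 + k) \<le> c / \<theta> ^ k" using c \<theta> by (intro divide_left_mono) auto
    then show ?thesis using \<rho>_decay[of k] by linarith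
  qed
  ultimately have "AE \<xi> in M. \<exists>m. ereal s \<le> hausdorff_dim {x\<in>window. \<forall>k\<ge>m. hit k \<xi> x}"
    by (intro AE_hausdorff_dim_hits_ge[OF \<theta> q01 _ c _ s sq])
  then show ?thesis
  proof eventually_elim
    case (elim \<xi>)
    then obtain m where m: "ereal s \<le> hausdorff_dim {x\<in>window. \<forall>k\<ge>m. hit k \<xi> x}" by blast
    also have "\<dots> \<le> hausdorff_dim (uniform_cover_set (\<lambda>n. c / real n) (\<lambda>n. \<omega> n \<xi>))"
    proof (rule hausdorff_dim_le_of_expanding[where f = to_torus])
      fix x y assume "x \<in> {x\<in>window. \<forall>k\<ge>m. hit k \<xi> x}" "y \<in> {x\<in>window. \<forall>k\<ge>m. hit k \<xi> x}"
      then have "1/8 \<le> x" "x \<le> 3/8" "1/8 \<le> y" "y \<le> 3/8" by simp_all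
      then have "\<bar>x - y\<bar> \<le> 1/2" by linarith
      then show "dist x y \<le> dist (to_torus x) (to_torus y)"
        by (simp add: dist_to_torus torus_norm_to_torus dist_real_def)
    next
      show "to_torus ` {x\<in>window. \<forall>k\<ge>m. hit k \<xi> x} \<subseteq> uniform_cover_set (\<lambda>n. c / real n) (\<lambda>n. \<omega> n \<xi>)"
      proof (rule image_subsetI)
        fix y assume y: "y \<in> {x\<in>window. \<forall>k\<ge>m. hit k \<xi> x}"
        show "to_torus y \<in> uniform_cover_set (\<lambda>n. c / real n) (\<lambda>n. \<omega> n \<xi>)"
        proof (rule mem_uniform_cover_set_of_blocks[OF c N_mono N_unbounded N_pos])
          fix k assume "m \<le> k"
          then obtain n where n: "n \<in> J k" "\<bar>W n \<xi> - y\<bar> \<le> \<rho> k" using y by (auto simp: hit_def)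
          have "y \<le> 3/8" using y by simp
          then have "arc_coord (\<omega> n \<xi>) \<le> 1/2"
            using n(2) \<rho>_le[of k] unfolding W_def by linarith
          then have "torus_norm (\<omega> n \<xi> - to_torus y) = torus_norm (to_torus (W n \<xi> - y))"
            using to_torus_arc_coord[of "\<omega> n \<xi>"] by (simp add: W_def minus_torus.abs_eq[symmetric])
          also have "\<dots> \<le> \<rho> k" using n(2) torus_norm_to_torus_le order_trans by blast
          finally show "\<exists>n\<in>{N k<..N (Suc k)}. torus_norm (\<omega> n \<xi> - to_torus y) \<le> c / real (N (k + 2))"
            using n(1) by (auto simp: J_def \<rho>_def)
        qed
      qed
    qed
    finally show ?case .
  qed
qed

section \<open>The numerical bound\<close>

lemma sum_exp_series_le_exp:
  fixes x :: real
  assumes "0 \<le> x"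
  shows "(\<Sum>i<n. x ^ i / fact i) \<le> exp x"
proof -
  have "(\<lambda>i. x ^ i / fact i) sums exp x"
    using exp_converges[of x] by (simp add: divide_inverse mult.commute)
  then have "summable (\<lambda>i. x ^ i / fact i)" "exp x = (\<Sum>i. x ^ i / fact i)"
    by (auto simp: sums_iff)
  then show ?thesis using assms by (simp add: sum_le_suminf)
qed

text \<open>
  At \<open>\<theta> = 8.6\<close> the bound exceeds \<open>0.2177444298485995\<close> by less than \<open>3 \<cdot> 10\<^bsup>-16\<^esup>\<close>. The point \<open>8.601\<close> is
  closer to the maximiser, so that the margin is about \<open>3 \<cdot> 10\<^bsup>-10\<^esup>\<close> and estimates to ten digits
  suffice. The fractions below have this accuracy and few digits: \<open>69803 / 339681\<close>
  lies just below the exponent, \<open>148941 / 801808\<close> just below \<open>P\<close>, and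
  \<open>801808 / 148941 = 4 \<cdot> 200452 / 148941\<close> and \<open>8.601 = 8 \<cdot> 1.075125\<close> separate powers of \<open>2\<close> from factors near
  \<open>1\<close>, for which the series of the logarithm converges quickly.
\<close>

lemma dimension_bound_at_8601:
  "0.2177444298485995
    \<le> 1 - (- ln (1 - exp (- 2 * 1 * ((8.601 - 1) / (8.601)\<^sup>2)))) / ln (8.601 :: real)"
proof -
  define a where "a = 2 * 1 * ((8.601 - 1) / (8.601)\<^sup>2 :: real)"
  define P where "P = 1 - exp (- a)"
  have P: "148941 / 801808 \<le> P"
  proof -
    have "(801808 / 652867 :: real) \<le> (\<Sum>i<9. (69803 / 339681) ^ i / fact i)"
      by (simp add: lessThan_nat_numeral fact_numeral power_divide)
    also have "\<dots> \<le> exp (69803 / 339681)" by (rule sum_exp_series_le_exp) simp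
    also have "\<dots> \<le> exp a"
    proof -
      have "69803 / 339681 \<le> a" unfolding a_def by (simp add: power_divide)
      then show ?thesis by simp
    qed
    finally have "exp (- a) \<le> 1 / (801808 / 652867)"
      by (simp only: exp_minus inverse_eq_divide) (intro divide_left_mono, simp_all)
    then show ?thesis unfolding P_def by simp
  qed
  have ln2: "0.69314718055 \<le> ln (2 :: real)"
    using ln_approx_bounds[of 2 11] by (simp add: lessThan_nat_numeral power_divide)
  have ln\<theta>: "0.07243693388 \<le> ln (1.075125 :: real)"
    using ln_approx_bounds[of "1.075125" 4] by (simp add: lessThan_nat_numeral power_divide)
  have lnX: "ln (200452 / 148941 :: real) \<le> 0.29702456222"
    using ln_approx_bounds[of "200452 / 148941" 5] by (simp add: lessThan_nat_numeral power_divide)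
  have "ln (8.601 :: real) = ln (2 ^ 3 * 1.075125)" by simp
  also have "\<dots> = ln (2 ^ 3) + ln 1.075125" by (rule ln_mult_pos) simp_all
  also have "ln (2 ^ 3 :: real) = 3 * ln 2" by (subst ln_realpow) simp_all
  finally have \<theta>: "ln (8.601 :: real) = 3 * ln 2 + ln 1.075125" .
  have "- ln P \<le> - ln (148941 / 801808)" using P by simp
  also have "\<dots> = ln (inverse (148941 / 801808))" by (rule ln_inverse[symmetric])
  also have "\<dots> = ln (2 ^ 2 * (200452 / 148941))" by simp
  also have "\<dots> = ln (2 ^ 2) + ln (200452 / 148941)" by (rule ln_mult_pos) simp_all
  also have "ln (2 ^ 2 :: real) = 2 * ln 2" by (subst ln_realpow) simp_all
  also have "2 * ln 2 + ln (200452 / 148941) \<le> (1 - 0.2177444298485995) * ln (8.601 :: real)"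
    unfolding \<theta> using ln2 ln\<theta> lnX by simp
  finally have "(- ln P) / ln 8.601 \<le> 1 - 0.2177444298485995"
    by (subst pos_divide_le_eq) simp_all
  then show ?thesis unfolding P_def a_def by (simp only: mult_minus_left)
qed

section \<open>Almost sure lower bounds\<close>

lemma AE_hausdorff_dim_uniform_cover_set_ge:
  fixes M :: "'a measure" and \<omega> :: "nat \<Rightarrow> 'a \<Rightarrow> torus"
  assumes "prob_space M"
    and "prob_space.indep_vars M (\<lambda>_. borel) \<omega> {1..}"
    and "\<And>n. n \<ge> 1 \<Longrightarrow> distr M borel (\<omega> n) = torus_uniform"
    and "0 < c" and "1 < \<theta>"
  shows "AE \<xi> in M. ereal (1 - (- ln (1 - exp (- 2 * c * ((\<theta> - 1) / \<theta>\<^sup>2)))) / ln \<theta>)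
    \<le> hausdorff_dim (uniform_cover_set (\<lambda>n. c / real n) (\<lambda>n. \<omega> n \<xi>))"
proof -
  define v where "v = 1 - (- ln (1 - exp (- 2 * c * ((\<theta> - 1) / \<theta>\<^sup>2)))) / ln \<theta>"
  let ?d = "\<lambda>\<xi>. hausdorff_dim (uniform_cover_set (\<lambda>n. c / real n) (\<lambda>n. \<omega> n \<xi>))"
  have "AE \<xi> in M. ereal v \<le> ?d \<xi>"
  proof (cases "v \<le> 0")
    case True
    have "ereal v \<le> ?d \<xi>" for \<xi>
      using True by (intro order_trans[OF _ hausdorff_dim_nonneg]) simp
    then show ?thesis by simp
  next
    case False
    \<comment> \<open>countably many exponents approaching \<open>v\<close> share one null set\<close>
    define s where "s j = v * (1 - 1 / real (Suc (Suc j)))" for j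
    have "AE \<xi> in M. ereal (s j) \<le> ?d \<xi>" for j
    proof (rule AE_hausdorff_dim_uniform_cover_set_ge_of_less[OF assms(1,2) _ assms(4,5)])
      show "distr M borel (\<omega> n) = torus_uniform" if "n \<ge> 1" for n using that by (rule assms(3))
      show "0 < s j" using False by (simp add: s_def)
      have "s j < v" using False by (simp add: s_def right_diff_distrib)
      then show "s j < 1 - (- ln (1 - exp (- 2 * c * ((\<theta> - 1) / \<theta>\<^sup>2)))) / ln \<theta>"
        by (simp only: v_def)
    qed
    then have "AE \<xi> in M. \<forall>j. ereal (s j) \<le> ?d \<xi>" by (simp add: AE_all_countable)
    then show ?thesis
    proof eventually_elim
      case (elim \<xi>)
      have "(\<lambda>j. v * (1 - 1 / real (Suc (Suc j)))) \<longlonglongrightarrow> v * (1 - 0)"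
        by (intro tendsto_intros LIMSEQ_Suc[OF LIMSEQ_Suc[OF lim_1_over_n]])
      then have "(\<lambda>j. ereal (s j)) \<longlonglongrightarrow> ereal v" by (simp add: s_def)
      then show ?case by (rule LIMSEQ_le_const2) (use elim in blast)
    qed
  qed
  then show ?thesis unfolding v_def .
qed

theorem theorem5:
  fixes M :: "'a measure" and \<omega> :: "nat \<Rightarrow> 'a \<Rightarrow> torus"
  assumes "prob_space M"
    and "prob_space.indep_vars M (\<lambda>_. borel) \<omega> {1..}"
    and "\<And>n. n \<ge> 1 \<Longrightarrow> distr M borel (\<omega> n) = torus_uniform"
  shows "(\<forall>c>0. \<forall>\<theta>>1. AE \<xi> in M.
            hausdorff_dim (uniform_cover_set (\<lambda>n. c / real n) (\<lambda>n. \<omega> n \<xi>))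
              \<ge> ereal (1 - (- ln (1 - exp (- 2 * c * ((\<theta> - 1) / \<theta>\<^sup>2)))) / ln \<theta>))
       \<and> (AE \<xi> in M.
            hausdorff_dim (uniform_cover_set (\<lambda>n. 1 / real n) (\<lambda>n. \<omega> n \<xi>))
              \<ge> ereal 0.2177444298485995)"
proof (intro conjI allI impI)
  fix c \<theta> :: real
  assume "0 < c" "1 < \<theta>"
  then show "AE \<xi> in M.
      hausdorff_dim (uniform_cover_set (\<lambda>n. c / real n) (\<lambda>n. \<omega> n \<xi>))
        \<ge> ereal (1 - (- ln (1 - exp (- 2 * c * ((\<theta> - 1) / \<theta>\<^sup>2)))) / ln \<theta>)"
    by (intro AE_hausdorff_dim_uniform_cover_set_ge assms)
next
  have le: "ereal 0.2177444298485995
      \<le> ereal (1 - (- ln (1 - exp (- 2 * 1 * ((8.601 - 1) / 8.601\<^sup>2)))) / ln 8.601)"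
    unfolding ereal_less_eq by (rule dimension_bound_at_8601)
  have "AE \<xi> in M. ereal (1 - (- ln (1 - exp (- 2 * 1 * ((8.601 - 1) / 8.601\<^sup>2)))) / ln 8.601)
      \<le> hausdorff_dim (uniform_cover_set (\<lambda>n. 1 / real n) (\<lambda>n. \<omega> n \<xi>))"
    by (intro AE_hausdorff_dim_uniform_cover_set_ge assms) simp_all
  then show "AE \<xi> in M.
      hausdorff_dim (uniform_cover_set (\<lambda>n. 1 / real n) (\<lambda>n. \<omega> n \<xi>)) \<ge> ereal 0.2177444298485995"
    by eventually_elim (rule order_trans[OF le])
qed

end
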